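(* Let $S_{2,0}$ be a closed orientable surface of genus two with $$\pi_1(S_{2,0})=\langle A_1,B_1,A_2,B_2\mid B_2^{-1}A_2^{-1}B_2A_2B_1^{-1}A_1^{-1}B_1A_1=1\rangle,$$ and let $\gamma_1,\ldots,\gamma_9$ be, respectively, the elements $$A_1,\ B_1,\ A_1B_1,\ A_2,\ B_2,\ A_2B_2,\ B_2^{-1}A_2^{-1}B_2A_2,\ A_2B_1^{-1}A_1^{-1}B_1,\ A_2A_1 .$$ Let $g$ be the hyperbolic metric on $S_{2,0}$ (unique up to isotopy) such that, with $x_i=\mathrm{Tr}_g(\gamma_i)$, $$x_1=x_2=x_3=x_4=x_5=x_6=x_8,\qquad x_9=\mathrm{Tr}_g(\gamma_1^2)=x_1^2-2.$$ Then the metric $g$ is non-arithmetic.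
   Context: For $\gamma\in\pi_1(S_{2,0})$, $\ell_g(\gamma)$ is the length of the closed geodesic freely homotopic to $\gamma$ and $\mathrm{Tr}_g(\gamma)=2\cosh(\ell_g(\gamma)/2)$. By a theorem of Keen, $g\mapsto(x_1,\ldots,x_9)$ identifies the Teichmüller space $T_{2,0}$ of $S_{2,0}$ (hyperbolic metrics up to isotopy) with the set of points of $\mathbb{R}^9$ with all $x_i>2$ satisfying $$x_1^2+x_2^2+x_3^2-x_1x_2x_3+x_7=2,\qquad x_4^2+x_5^2+x_6^2-x_4x_5x_6+x_7=2,$$ $$x_7^2+x_8^2+x_9^2-x_7x_8x_9+(x_1^2+x_4^2)x_7+2x_1x_4(x_8+x_9)+2x_1^2+2x_4^2+x_1^2x_4^2=4.$$ Arithmeticity: let $k$ be a totally real number field and $A$ a quaternion algebra over $k$ which is unramified at exactly one real place (the identity embedding) and ramified at all the other real places, so that $A\otimes_{\mathbb{Q}}\mathbb{R}\cong M_2(\mathbb{R})\oplus\mathbf{H}\oplus\cdots\oplus\mathbf{H}$, with $\mathbf{H}$ Hamilton's quaternions. For an order $\mathcal{O}$ in $A$, let $\mathcal{O}^1$ be its group of elements of reduced norm $1$; its image in $\operatorname{PSL}(2,\mathbb{R})$ under projection to the first factor is a lattice. A Fuchsian lattice is arithmetic if it is commensurable (up to conjugation) with such an image. A hyperbolic metric is arithmetic if the Fuchsian lattice in $\operatorname{PSL}(2,\mathbb{R})$ given by the fundamental group is arithmetic. *)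

theory Defs
  imports "HOL-Analysis.Analysis" "HOL-Algebra.Coset"
    "HOL-Computational_Algebra.Computational_Algebra"
begin

section \<open>The group PSL(2,R) and its action on the hyperbolic plane\<close>

definition SL2R :: "(real^2^2) monoid"
  where "SL2R = \<lparr>carrier = {M. det M = 1}, mult = (**), one = mat 1\<rparr>"

definition PSL2R :: "(real^2^2) set monoid"
  where "PSL2R = SL2R Mod {mat 1, - mat 1}"

lemma group_SL2R: "group SL2R"
proof (rule groupI)
  fix M assume "M \<in> carrier SL2R"
  then have d: "det M = 1" by (simp add: SL2R_def)
  then have "invertible M" by (simp add: invertible_det_nz)
  then obtain N where N: "M ** N = mat 1" "N ** M = mat 1"
    unfolding invertible_def by blast
  from N(2) d have "det N = 1" by (metis det_I det_mul mult.right_neutral)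
  with N show "\<exists>N\<in>carrier SL2R. N \<otimes>\<^bsub>SL2R\<^esub> M = \<one>\<^bsub>SL2R\<^esub>"
    by (auto simp: SL2R_def)
qed (auto simp: SL2R_def det_mul matrix_mul_assoc)

lemma pm_one_normal: "{mat 1, - mat 1} \<lhd> SL2R"
proof -
  interpret group SL2R by (rule group_SL2R)
  have d: "det (- mat 1 :: real^2^2) = 1"
    by (simp add: det_2 mat_def)
  have n: "(- mat 1) ** M = - M" "M ** (- mat 1) = - M" for M :: "real^2^2"
    by (simp_all add: vec_eq_iff forall_2 matrix_matrix_mult_def sum_2 mat_def)
  have i: "inv\<^bsub>SL2R\<^esub> (- mat 1) = (- mat 1)"
    by (rule inv_equality) (use d n in \<open>auto simp: SL2R_def\<close>)
  have i1: "inv\<^bsub>SL2R\<^esub> (mat 1) = mat 1"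
    by (rule inv_equality) (auto simp: SL2R_def)
  have s: "subgroup {mat 1, - mat 1} SL2R"
  proof
    show "inv\<^bsub>SL2R\<^esub> x \<in> {mat 1, - mat 1}" if "x \<in> {mat 1, - mat 1}" for x
      using that i i1 by auto
  qed (use d n in \<open>auto simp: SL2R_def\<close>)
  show ?thesis
  proof (rule normalI[OF s], rule ballI)
    fix M show "{mat 1, - mat 1} #>\<^bsub>SL2R\<^esub> M = M <#\<^bsub>SL2R\<^esub> {mat 1, - mat 1}"
      by (auto simp: r_coset_def l_coset_def SL2R_def n)
  qed
qed

lemma group_PSL2R: "group PSL2R"
  unfolding PSL2R_def by (rule normal.factorgroup_is_group[OF pm_one_normal])

definition upper_halfplane :: "complex set"
  where "upper_halfplane = {z. Im z > 0}"

definition moebius :: "real^2^2 \<Rightarrow> complex \<Rightarrow> complex"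
  where "moebius M z =
    (of_real (M$1$1) * z + of_real (M$1$2)) / (of_real (M$2$1) * z + of_real (M$2$2))"

definition hyp_dist :: "complex \<Rightarrow> complex \<Rightarrow> real"
  where "hyp_dist z w = arcosh (1 + (cmod (z - w))\<^sup>2 / (2 * Im z * Im w))"

text \<open>Complete geodesics of the hyperbolic plane, parametrised by arc length; all of them
  are globally distance minimising.\<close>

definition geodesic_line :: "(real \<Rightarrow> complex) \<Rightarrow> bool"
  where "geodesic_line c \<longleftrightarrow>
    (\<forall>t. c t \<in> upper_halfplane) \<and> (\<forall>s t. hyp_dist (c s) (c t) = \<bar>s - t\<bar>)"

section \<open>The fundamental group of the closed surface of genus two\<close>

datatype surface_gen = A1 | B1 | A2 | B2

text \<open>The letter \<open>(s, True)\<close> stands for the generator \<open>s\<close> and \<open>(s, False)\<close> for its inverse.\<close>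

type_synonym surface_word = "(surface_gen \<times> bool) list"

abbreviation pos :: "surface_gen \<Rightarrow> surface_gen \<times> bool" where "pos s \<equiv> (s, True)"
abbreviation neg :: "surface_gen \<Rightarrow> surface_gen \<times> bool" where "neg s \<equiv> (s, False)"

inductive surface_eq :: "surface_word \<Rightarrow> surface_word \<Rightarrow> bool" where
  refl: "surface_eq u u"
| sym: "surface_eq u v \<Longrightarrow> surface_eq v u"
| trans: "surface_eq u v \<Longrightarrow> surface_eq v w \<Longrightarrow> surface_eq u w"
| cong: "surface_eq u u' \<Longrightarrow> surface_eq v v' \<Longrightarrow> surface_eq (u @ v) (u' @ v')"
| cancel: "surface_eq [(s, e), (s, \<not> e)] []"
| relator: "surface_eq [neg B2, neg A2, pos B2, pos A2, neg B1, neg A1, pos B1, pos A1] []"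

definition surface_class :: "surface_word \<Rightarrow> surface_word set"
  where "surface_class w = {v. surface_eq w v}"

definition surface_group :: "surface_word set monoid"
  where "surface_group =
    \<lparr>carrier = range surface_class,
     mult = (\<lambda>X Y. {w. \<exists>u\<in>X. \<exists>v\<in>Y. surface_eq (u @ v) w}),
     one = surface_class []\<rparr>"

lemma surface_class_eq_iff: "surface_class u = surface_class v \<longleftrightarrow> surface_eq u v"
  unfolding surface_class_def by (blast intro: surface_eq.intros(1-3))

lemma surface_mult_class:
  "surface_class u \<otimes>\<^bsub>surface_group\<^esub> surface_class v = surface_class (u @ v)"
  unfolding surface_class_def surface_group_def
  by (auto intro: surface_eq.intros(1-4))

lemma surface_inverse: "surface_eq (rev (map (\<lambda>(s, e). (s, \<not> e)) w) @ w) []"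
proof (induction w)
  case Nil
  show ?case by (simp add: surface_eq.refl)
next
  case (Cons a w)
  obtain s e where a: "a = (s, e)" by (cases a)
  let ?r = "rev (map (\<lambda>(s, e). (s, \<not> e)) w)"
  have "surface_eq [(s, \<not> e), (s, e)] []"
    using surface_eq.cancel[of s "\<not> e"] by simp
  then have "surface_eq (?r @ [(s, \<not> e), (s, e)] @ w) (?r @ [] @ w)"
    by (intro surface_eq.cong surface_eq.refl)
  with Cons show ?case
    by (auto simp: a intro: surface_eq.trans)
qed

lemma group_surface_group: "group surface_group"
proof (rule groupI)
  fix X assume "X \<in> carrier surface_group"
  then obtain w where X: "X = surface_class w" by (auto simp: surface_group_def)
  let ?v = "rev (map (\<lambda>(s, e). (s, \<not> e)) w)"
  have "surface_class ?v \<otimes>\<^bsub>surface_group\<^esub> X = \<one>\<^bsub>surface_group\<^esub>"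
    unfolding X surface_mult_class
    by (simp add: surface_group_def surface_class_eq_iff surface_inverse)
  then show "\<exists>Y\<in>carrier surface_group. Y \<otimes>\<^bsub>surface_group\<^esub> X = \<one>\<^bsub>surface_group\<^esub>"
    by (auto simp: surface_group_def)
next
  show "\<one>\<^bsub>surface_group\<^esub> \<in> carrier surface_group" by (simp add: surface_group_def)
next
  fix X Y Z
  assume "X \<in> carrier surface_group" "Y \<in> carrier surface_group"
  then obtain u v where uv: "X = surface_class u" "Y = surface_class v"
    by (auto simp: surface_group_def)
  show "X \<otimes>\<^bsub>surface_group\<^esub> Y \<in> carrier surface_group"
    unfolding uv surface_mult_class by (simp add: surface_group_def)
  assume "Z \<in> carrier surface_group"
  then obtain w where w: "Z = surface_class w" by (auto simp: surface_group_def)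
  show "X \<otimes>\<^bsub>surface_group\<^esub> Y \<otimes>\<^bsub>surface_group\<^esub> Z =
      X \<otimes>\<^bsub>surface_group\<^esub> (Y \<otimes>\<^bsub>surface_group\<^esub> Z)"
    unfolding uv w surface_mult_class by simp
next
  fix X assume "X \<in> carrier surface_group"
  then obtain w where X: "X = surface_class w" by (auto simp: surface_group_def)
  have "surface_class [] \<otimes>\<^bsub>surface_group\<^esub> X = X"
    unfolding X surface_mult_class by simp
  then show "\<one>\<^bsub>surface_group\<^esub> \<otimes>\<^bsub>surface_group\<^esub> X = X"
    by (simp add: surface_group_def)
qed

definition gamma :: "nat \<Rightarrow> surface_word set"
  where "gamma i = surface_class
    ([[pos A1],
      [pos B1],
      [pos A1, pos B1],
      [pos A2],
      [pos B2],
      [pos A2, pos B2],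
      [neg B2, neg A2, pos B2, pos A2],
      [pos A2, neg B1, neg A1, pos B1],
      [pos A2, pos A1]] ! (i - 1))"

section \<open>Hyperbolic metrics on the closed surface of genus two\<close>

text \<open>
  A hyperbolic metric on the surface, up to isotopy, is given by its holonomy representation
  \<open>\<rho>\<close>, well defined up to conjugation: the action of the fundamental group by deck
  transformations on the universal cover, which is isometric to the hyperbolic plane. The
  action is free (so \<open>\<rho>\<close> is injective), has discrete image (equivalently, it is properly
  discontinuous) and is cocompact (the surface is compact). The elements of \<open>PSL2R\<close> being pairs
  \<open>{M, - M}\<close>, the union of the image of \<open>\<rho>\<close> is its full preimage in SL(2,R), and the image
  is discrete if and only if this preimage is.
\<close>

definition hyperbolic_metric :: "(surface_word set \<Rightarrow> (real^2^2) set) \<Rightarrow> bool"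
  where "hyperbolic_metric \<rho> \<longleftrightarrow>
    \<rho> \<in> hom surface_group PSL2R \<and>
    (\<forall>\<gamma>\<in>carrier surface_group. \<gamma> \<noteq> \<one>\<^bsub>surface_group\<^esub> \<longrightarrow>
      (\<forall>M\<in>\<rho> \<gamma>. \<forall>z\<in>upper_halfplane. moebius M z \<noteq> z)) \<and>
    discrete (\<Union>(\<rho> ` carrier surface_group)) \<and>
    (\<exists>K. compact K \<and> K \<subseteq> upper_halfplane \<and>
      (\<forall>z\<in>upper_halfplane. \<exists>M\<in>\<Union>(\<rho> ` carrier surface_group). moebius M z \<in> K))"

text \<open>
  The closed geodesics freely homotopic to \<open>\<gamma>\<close> are the projections of the geodesic lines
  that are translated along themselves by \<open>\<rho> \<gamma>\<close>. For \<open>\<gamma> \<noteq> 1\<close> such a line exists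
  (it is the axis of \<open>\<rho> \<gamma>\<close>) and is unique up to reparametrisation. For \<open>\<gamma> = 1\<close>
  there is none and the value is unspecified.
\<close>

definition geodesic_length :: "(surface_word set \<Rightarrow> (real^2^2) set) \<Rightarrow> surface_word set \<Rightarrow> real"
  where "geodesic_length \<rho> \<gamma> =
    (THE l. l > 0 \<and>
      (\<exists>c. geodesic_line c \<and> (\<forall>M\<in>\<rho> \<gamma>. \<forall>t. moebius M (c t) = c (t + l))))"

definition Tr :: "(surface_word set \<Rightarrow> (real^2^2) set) \<Rightarrow> surface_word set \<Rightarrow> real"
  where "Tr \<rho> \<gamma> = 2 * cosh (geodesic_length \<rho> \<gamma> / 2)"

section \<open>Totally real number fields\<close>

text \<open>A number field comes with a distinguished real embedding here, so it is taken to be a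
  subfield of the reals and that embedding to be the inclusion.\<close>

definition real_number_field :: "real set \<Rightarrow> bool"
  where "real_number_field k \<longleftrightarrow>
    1 \<in> k \<and> (\<forall>x\<in>k. \<forall>y\<in>k. x - y \<in> k \<and> x * y \<in> k) \<and> (\<forall>x\<in>k. inverse x \<in> k) \<and>
    (\<exists>S. finite S \<and> S \<subseteq> k \<and> (\<forall>x\<in>k. \<exists>q :: real \<Rightarrow> rat. x = (\<Sum>s\<in>S. of_rat (q s) * s)))"

text \<open>Only the values on \<open>k\<close> matter.\<close>

definition field_embedding :: "real set \<Rightarrow> (real \<Rightarrow> 'a::field) \<Rightarrow> bool"
  where "field_embedding k \<sigma> \<longleftrightarrow>
    \<sigma> 1 = 1 \<and> (\<forall>x\<in>k. \<forall>y\<in>k. \<sigma> (x + y) = \<sigma> x + \<sigma> y \<and> \<sigma> (x * y) = \<sigma> x * \<sigma> y)"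

definition totally_real :: "real set \<Rightarrow> bool"
  where "totally_real k \<longleftrightarrow>
    (\<forall>\<sigma> :: real \<Rightarrow> complex. field_embedding k \<sigma> \<longrightarrow> \<sigma> ` k \<subseteq> \<real>)"

definition ring_of_integers :: "real set \<Rightarrow> real set"
  where "ring_of_integers k = {x\<in>k. algebraic_int x}"

section \<open>Quaternion algebras\<close>

text \<open>
  For nonzero \<open>a\<close>, \<open>b\<close> in a subfield \<open>k\<close> of the reals, the quaternion algebra
  \<open>(a, b)\<close> over \<open>k\<close> has the basis 1, i, j, ij with \<open>i\<^sup>2 = a\<close>, \<open>j\<^sup>2 = b\<close> and
  \<open>ij = -ji\<close>; every quaternion algebra over \<open>k\<close> is of this form. Its elements are the
  coordinate vectors with entries in \<open>k\<close>, so that the real algebra \<open>(a, b)\<close> is its scalar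
  extension along the inclusion of \<open>k\<close>, and for a real embedding \<open>\<sigma>\<close> of \<open>k\<close> the real
  algebra \<open>(\<sigma> a, \<sigma> b)\<close> is its scalar extension along \<open>\<sigma>\<close>.
\<close>

type_synonym quat = "real \<times> real \<times> real \<times> real"

fun quat_mult :: "real \<Rightarrow> real \<Rightarrow> quat \<Rightarrow> quat \<Rightarrow> quat"
  where "quat_mult a b (x0, x1, x2, x3) (y0, y1, y2, y3) =
    (x0 * y0 + a * x1 * y1 + b * x2 * y2 - a * b * x3 * y3,
     x0 * y1 + x1 * y0 - b * x2 * y3 + b * x3 * y2,
     x0 * y2 + x2 * y0 + a * x1 * y3 - a * x3 * y1,
     x0 * y3 + x3 * y0 + x1 * y2 - x2 * y1)"

abbreviation quat_one :: quat where "quat_one \<equiv> (1, 0, 0, 0)"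

fun reduced_norm :: "real \<Rightarrow> real \<Rightarrow> quat \<Rightarrow> real"
  where "reduced_norm a b (x0, x1, x2, x3) =
    x0\<^sup>2 - a * x1\<^sup>2 - b * x2\<^sup>2 + a * b * x3\<^sup>2"

definition quat_algebra :: "real set \<Rightarrow> quat set"
  where "quat_algebra k = k \<times> k \<times> k \<times> k"

definition matrix_iso :: "real \<Rightarrow> real \<Rightarrow> (quat \<Rightarrow> real^2^2) \<Rightarrow> bool"
  where "matrix_iso a b \<Phi> \<longleftrightarrow> linear \<Phi> \<and> bij \<Phi> \<and>
    (\<forall>x y. \<Phi> (quat_mult a b x y) = \<Phi> x ** \<Phi> y)"

definition hamilton_iso :: "real \<Rightarrow> real \<Rightarrow> (quat \<Rightarrow> quat) \<Rightarrow> bool"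
  where "hamilton_iso a b \<Phi> \<longleftrightarrow> linear \<Phi> \<and> bij \<Phi> \<and>
    (\<forall>x y. \<Phi> (quat_mult a b x y) = quat_mult (- 1) (- 1) (\<Phi> x) (\<Phi> y))"

text \<open>Unramified at the identity embedding and ramified at every other real place.\<close>

definition unramified_exactly_at_id :: "real set \<Rightarrow> real \<Rightarrow> real \<Rightarrow> bool"
  where "unramified_exactly_at_id k a b \<longleftrightarrow>
    (\<exists>\<Phi>. matrix_iso a b \<Phi>) \<and>
    (\<forall>\<sigma> :: real \<Rightarrow> real. field_embedding k \<sigma> \<and> (\<exists>x\<in>k. \<sigma> x \<noteq> x) \<longrightarrow>
      (\<exists>\<Phi>. hamilton_iso (\<sigma> a) (\<sigma> b) \<Phi>))"

text \<open>Orders: subrings that are finitely generated over the ring of integers of \<open>k\<close> and span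
  the algebra over \<open>k\<close>.\<close>

definition quat_order :: "real set \<Rightarrow> real \<Rightarrow> real \<Rightarrow> quat set \<Rightarrow> bool"
  where "quat_order k a b O' \<longleftrightarrow>
    O' \<subseteq> quat_algebra k \<and> quat_one \<in> O' \<and>
    (\<forall>x\<in>O'. \<forall>y\<in>O'. x - y \<in> O' \<and> quat_mult a b x y \<in> O') \<and>
    (\<exists>S. finite S \<and>
      O' = {\<Sum>s\<in>S. r s *\<^sub>R s | r. \<forall>s\<in>S. r s \<in> ring_of_integers k}) \<and>
    (\<forall>x\<in>quat_algebra k. \<exists>S c. finite S \<and> S \<subseteq> O' \<and> (\<forall>s\<in>S. c s \<in> k) \<and>
      x = (\<Sum>s\<in>S. c s *\<^sub>R s))"

section \<open>Arithmetic Fuchsian groups\<close>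

text \<open>The image in PSL(2,R) of the norm one units of an order.\<close>

definition norm_one_image :: "real \<Rightarrow> real \<Rightarrow> (quat \<Rightarrow> real^2^2) \<Rightarrow> quat set \<Rightarrow> (real^2^2) set set"
  where "norm_one_image a b \<Phi> O' =
    (\<lambda>x. {\<Phi> x, - \<Phi> x}) ` {x\<in>O'. reduced_norm a b x = 1}"

definition commensurable :: "('a, 'b) monoid_scheme \<Rightarrow> 'a set \<Rightarrow> 'a set \<Rightarrow> bool"
  where "commensurable G H K \<longleftrightarrow>
    finite (rcosets\<^bsub>G\<lparr>carrier := H\<rparr>\<^esub> (H \<inter> K)) \<and>
    finite (rcosets\<^bsub>G\<lparr>carrier := K\<rparr>\<^esub> (H \<inter> K))"

definition arithmetic :: "(real^2^2) set set \<Rightarrow> bool"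
  where "arithmetic \<Gamma> \<longleftrightarrow>
    (\<exists>k a b \<Phi> O' h.
      real_number_field k \<and> totally_real k \<and>
      a \<in> k \<and> b \<in> k \<and> a \<noteq> 0 \<and> b \<noteq> 0 \<and>
      unramified_exactly_at_id k a b \<and> quat_order k a b O' \<and> matrix_iso a b \<Phi> \<and>
      h \<in> carrier PSL2R \<and>
      commensurable PSL2R \<Gamma>
        ((\<lambda>X. h \<otimes>\<^bsub>PSL2R\<^esub> X \<otimes>\<^bsub>PSL2R\<^esub> inv\<^bsub>PSL2R\<^esub> h) ` norm_one_image a b \<Phi> O'))"

definition arithmetic_metric :: "(surface_word set \<Rightarrow> (real^2^2) set) \<Rightarrow> bool"
  where "arithmetic_metric \<rho> \<longleftrightarrow> arithmetic (\<rho> ` carrier surface_group)"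

end

theory Submission
  imports Defs
begin

text \<open>
  Lift the generators to SL(2,R) with positive traces \<open>x\<close>. The lifts of the other curves have traces
  known up to sign, and the trace identities for commutators and for three matrices leave eight
  polynomial equations for \<open>x\<close>. Seven of them have no admissible root, and the eighth is
  \<open>x\<^sup>5 - 9x\<^sup>4 + 2x\<^sup>3 + 11x\<^sup>2 - 4x - 4 = 0\<close>, so the geometric input behind the signs in Keen's
  equations is not needed. This quintic is irreducible over the rationals, with one root \<open>x\<close> in \<open>(8, 9)\<close>
  and a nonreal root \<open>z\<close> with \<open>\<bar>z\<bar> < 3\<close>.

  If the metric were arithmetic, some power of the lift of \<open>A\<^sub>1\<close> would come from a quaternion of norm one,
  hence its trace \<open>T\<^sub>n(x)\<close>, where \<open>T\<^sub>n(l + 1/l) = l\<^sup>n + 1/l\<^sup>n\<close>, would lie in the totally real field \<open>k\<close>. Extend \<open>x \<mapsto> z\<close> to an embedding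
  of \<open>k(x)\<close> in the complex numbers and restrict it to \<open>k\<close>. If the restriction is not the identity,
  ramification gives \<open>\<bar>T\<^sub>n(z)\<bar> \<le> 2\<close>, which forces \<open>z\<close> to be real; if it is, then \<open>T\<^sub>n(z) = T\<^sub>n(x)\<close>,
  which forces \<open>\<bar>z\<bar>\<close> to be large.
\<close>

section \<open>Moebius transformations and translation lengths\<close>

text \<open>\<open>Tr\<close> is a definite description over axes, so nothing can be computed before
  two facts are known: a translation length determines the absolute value of the trace, and no
  nontrivial element is elliptic or parabolic. Freeness excludes the former, discreteness together
  with cocompactness the latter. Three signs of traces stay free, whence eight equations. Two more
  signs, that of the lift of \<open>A2 B2\<close> and that of the lifted surface relation, are
  settled by the trace formula for commutators. On the arithmetic side the obstacle is that x itself
  need not lie in \<open>k\<close>; only a value of T_n at x does, up to sign. The embedding must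
  therefore live on a field containing both \<open>k\<close> and x, and irreducibility of the
  quintic is what permits x to be sent to z. The constants 8 and 3 serve the last step. If x = l +
  1/l with l > 1, then x > 8 gives l > 7, and equality of the two values of T_n would give |z| at
  least l - 1/l > 6.\<close>

definition mat2 :: "real \<Rightarrow> real \<Rightarrow> real \<Rightarrow> real \<Rightarrow> real^2^2"
  where "mat2 a b c d = vector [vector [a, b], vector [c, d]]"

lemma mat2_nth [simp]:
  "vec_nth (vec_nth (mat2 a b c d) 1) 1 = a" "vec_nth (vec_nth (mat2 a b c d) 1) 2 = b"
  "vec_nth (vec_nth (mat2 a b c d) 2) 1 = c" "vec_nth (vec_nth (mat2 a b c d) 2) 2 = d"
  by (simp_all add: mat2_def)

lemma mat2_eq_iff [simp]: "mat2 a b c d = mat2 a' b' c' d' \<longleftrightarrow> a = a' \<and> b = b' \<and> c = c' \<and> d = d'"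
  by (auto simp: vec_eq_iff forall_2)

lemma mat2_cases [cases type]: obtains a b c d where "(M :: real^2^2) = mat2 a b c d"
proof
  show "M = mat2 (vec_nth (vec_nth M 1) 1) (vec_nth (vec_nth M 1) 2)
    (vec_nth (vec_nth M 2) 1) (vec_nth (vec_nth M 2) 2)"
    by (simp add: vec_eq_iff forall_2)
qed

lemma mat2_mult [simp]:
  "mat2 a b c d ** mat2 a' b' c' d' =
    mat2 (a * a' + b * c') (a * b' + b * d') (c * a' + d * c') (c * b' + d * d')"
  by (simp add: vec_eq_iff forall_2 matrix_matrix_mult_def sum_2)

lemma det_mat2 [simp]: "det (mat2 a b c d) = a * d - b * c"
  by (simp add: det_2)

lemma trace_mat2 [simp]: "trace (mat2 a b c d) = a + d"
  by (simp add: trace_def sum_2)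

lemma mat_mat2: "mat x = mat2 x 0 0 x"
  by (simp add: vec_eq_iff forall_2 mat_def)

lemma uminus_mat2 [simp]: "- mat2 a b c d = mat2 (- a) (- b) (- c) (- d)"
  by (simp add: vec_eq_iff forall_2)

lemma moebius_mat2:
  "moebius (mat2 a b c d) z = (of_real a * z + of_real b) / (of_real c * z + of_real d)"
  by (simp add: moebius_def)

lemma det_uminus_2 [simp]: "det (- M) = det (M :: real^2^2)"
  by (cases M) simp

lemma trace_uminus_2 [simp]: "trace (- M) = - trace (M :: real^2^2)"
  by (cases M) simp

lemma moebius_uminus [simp]: "moebius (- M) z = moebius M z"
proof (cases M)
  case (1 a b c d)
  have "(- u - v) / (- u' - v') = (u + v) / (u' + v')" for u v u' v' :: complex
    using minus_divide_divide[of "u + v" "u' + v'"] by simp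
  then show ?thesis by (simp add: 1 moebius_mat2)
qed

lemma moebius_denom_nonzero:
  assumes "a * d - b * c = (1::real)" "Im z > 0"
  shows "of_real c * z + of_real d \<noteq> 0"
proof
  assume *: "of_real c * z + of_real d = 0"
  then have "c * Im z = 0" "c * Re z + d = 0"
    by (auto simp: complex_eq_iff)
  with assms show False by auto
qed

lemma Im_moebius:
  assumes "det (mat2 a b c d) = 1" "Im z \<noteq> 0"
  shows "Im (moebius (mat2 a b c d) z) = Im z / (cmod (of_real c * z + of_real d))\<^sup>2"
proof -
  have "a * d - b * c = 1" using assms by simp
  moreover have "a * Im z * (c * Re z + d) - (a * Re z + b) * (c * Im z) = (a * d - b * c) * Im z"
    by (simp add: algebra_simps)
  ultimately show ?thesis
    by (simp add: moebius_mat2 Im_divide cmod_power2)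
qed

lemma moebius_upper_halfplane:
  assumes "det M = 1" "z \<in> upper_halfplane"
  shows "moebius M z \<in> upper_halfplane"
proof (cases M)
  case (1 a b c d)
  have z: "Im z > 0" using assms by (simp add: upper_halfplane_def)
  moreover have "of_real c * z + of_real d \<noteq> 0"
    using assms z by (intro moebius_denom_nonzero[of a d b c z]) (auto simp: 1)
  ultimately show ?thesis
    using Im_moebius[of a b c d z] assms unfolding upper_halfplane_def 1
    by simp
qed

lemma moebius_mult:
  assumes "det N = 1" "z \<in> upper_halfplane"
  shows "moebius (M ** N) z = moebius M (moebius N z)"
proof (cases M, cases N)
  fix a b c d a' b' c' d'
  assume 1: "M = mat2 a b c d" and 2: "N = mat2 a' b' c' d'"
  have nz: "of_real c' * z + of_real d' \<noteq> 0"
    using assms by (intro moebius_denom_nonzero[of a' d' b' c' z]) (auto simp: 2 upper_halfplane_def)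
  let ?n = "of_real a' * z + of_real b'" and ?e = "of_real c' * z + of_real d'"
  have "(p * (n / e) + q) / (r * (n / e) + s) = (p * n + q * e) / (r * n + s * e)"
    if "e \<noteq> 0" for p q r s n e :: complex
  proof -
    have "p * (n / e) + q = (p * n + q * e) / e" "r * (n / e) + s = (r * n + s * e) / e"
      using that by (simp_all add: field_simps)
    then show ?thesis using that by simp
  qed
  from this[OF nz, of "of_real a" ?n "of_real b" "of_real c" "of_real d"] show ?thesis
    by (simp add: 1 2 moebius_mat2 algebra_simps)
qed

text \<open>Equals \<open>2 * (cosh d - 1)\<close> for the hyperbolic distance \<open>d\<close>; a
  rational expression that is easier to transport than \<open>arcosh\<close>.\<close>

definition point_pair :: "complex \<Rightarrow> complex \<Rightarrow> real"
  where "point_pair z w = (cmod (z - w))\<^sup>2 / (Im z * Im w)"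

lemma hyp_dist_point_pair: "hyp_dist z w = arcosh (1 + point_pair z w / 2)"
  by (simp add: hyp_dist_def point_pair_def mult_ac)

lemma point_pair_nonneg: "z \<in> upper_halfplane \<Longrightarrow> w \<in> upper_halfplane \<Longrightarrow> point_pair z w \<ge> 0"
  by (simp add: point_pair_def upper_halfplane_def)

lemma point_pair_moebius:
  assumes "det M = 1" "z \<in> upper_halfplane" "w \<in> upper_halfplane"
  shows "point_pair (moebius M z) (moebius M w) = point_pair z w"
proof (cases M)
  case (1 a b c d)
  let ?e = "\<lambda>z. of_real c * z + of_real d"
  have nz: "?e z \<noteq> 0" "?e w \<noteq> 0"
    using assms moebius_denom_nonzero[of a d b c] by (auto simp: 1 upper_halfplane_def)
  have im: "Im z > 0" "Im w > 0" using assms by (auto simp: upper_halfplane_def)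
  have det: "a * d - b * c = 1" using assms 1 by simp
  have "(of_real a * z + of_real b) * ?e w - (of_real a * w + of_real b) * ?e z
      = of_real (a * d - b * c) * (z - w)"
    by (simp add: algebra_simps)
  then have "moebius M z - moebius M w = (z - w) / (?e z * ?e w)"
    unfolding 1 moebius_mat2 det using nz by (simp add: diff_frac_eq)
  then have "(cmod (moebius M z - moebius M w))\<^sup>2 = (cmod (z - w))\<^sup>2 / ((cmod (?e z))\<^sup>2 * (cmod (?e w))\<^sup>2)"
    by (simp add: norm_divide norm_mult power_divide power_mult_distrib)
  moreover have "Im (moebius M z) = Im z / (cmod (?e z))\<^sup>2" "Im (moebius M w) = Im w / (cmod (?e w))\<^sup>2"
    using im det unfolding 1 by (auto intro!: Im_moebius)
  moreover have "(r / (p\<^sup>2 * q\<^sup>2)) / ((u / p\<^sup>2) * (v / q\<^sup>2)) = r / (u * v)"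
    if "p \<noteq> 0" "q \<noteq> 0" for p q r u v :: real
    using that by (simp add: field_simps)
  ultimately show ?thesis
    unfolding point_pair_def using nz by simp
qed

text \<open>The numerator of \<open>z - moebius M z\<close> over the denominator
  \<open>c * z + d\<close>. It is linear in \<open>M\<close> and vanishes on scalar matrices, which
  is why Cayley-Hamilton controls it.\<close>

definition fixed_form :: "real^2^2 \<Rightarrow> complex \<Rightarrow> complex"
  where "fixed_form M z = of_real (vec_nth (vec_nth M 2) 1) * z\<^sup>2
    + of_real (vec_nth (vec_nth M 2) 2 - vec_nth (vec_nth M 1) 1) * z - of_real (vec_nth (vec_nth M 1) 2)"

text \<open>The squared distance from \<open>z\<close> to its image and the imaginary part of the
  image both carry the factor \<open>1 / |c z + d|^2\<close>, which cancels.\<close>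

lemma point_pair_displacement:
  assumes "det M = 1" "z \<in> upper_halfplane"
  shows "point_pair z (moebius M z) = (cmod (fixed_form M z))\<^sup>2 / (Im z)\<^sup>2"
proof (cases M)
  case (1 a b c d)
  let ?e = "of_real c * z + of_real d"
  have nz: "?e \<noteq> 0"
    using assms moebius_denom_nonzero[of a d b c z] by (auto simp: 1 upper_halfplane_def)
  have im: "Im z > 0" using assms by (auto simp: upper_halfplane_def)
  have "z - moebius M z = fixed_form M z / ?e"
    using nz by (simp add: 1 moebius_mat2 fixed_form_def field_simps power2_eq_square)
  then have "(cmod (z - moebius M z))\<^sup>2 = (cmod (fixed_form M z))\<^sup>2 / (cmod ?e)\<^sup>2"
    by (simp add: norm_divide power_divide)
  moreover have "Im (moebius M z) = Im z / (cmod ?e)\<^sup>2"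
    using im assms unfolding 1 by (intro Im_moebius) auto
  moreover have "(p / q\<^sup>2) / (y * (y / q\<^sup>2)) = p / y\<^sup>2" if "q \<noteq> 0" for p q y :: real
    using that by (simp add: field_simps power2_eq_square)
  ultimately show ?thesis
    unfolding point_pair_def using nz by (metis norm_eq_zero)
qed

lemma fixed_form_square: "fixed_form (M ** M) z = of_real (trace M) * fixed_form M z"
  by (cases M) (simp add: fixed_form_def algebra_simps)

lemma moebius_fixed_iff:
  assumes "det M = 1" "z \<in> upper_halfplane"
  shows "moebius M z = z \<longleftrightarrow> fixed_form M z = 0"
proof -
  have "moebius M z \<in> upper_halfplane" by (rule moebius_upper_halfplane[OF assms])
  then have "moebius M z = z \<longleftrightarrow> point_pair z (moebius M z) = 0"
    using assms by (auto simp: point_pair_def upper_halfplane_def)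
  also have "\<dots> \<longleftrightarrow> fixed_form M z = 0"
    using assms by (simp add: point_pair_displacement upper_halfplane_def)
  finally show ?thesis .
qed

text \<open>By Cayley-Hamilton, squaring \<open>M\<close> scales the fixed form, hence \<open>sqrt (cosh d - 1)\<close> for the displacement
  \<open>d\<close> of a point, by the trace; comparing the displacements \<open>l\<close> and \<open>2l\<close> on the axis gives the
  trace without diagonalising.\<close>

lemma translation_length_trace:
  assumes "det M = 1" "geodesic_line c" "l > 0" "\<And>t. moebius M (c t) = c (t + l)"
  shows "\<bar>trace M\<bar> = 2 * cosh (l / 2)"
proof -
  have H: "c t \<in> upper_halfplane" for t using assms(2) by (simp add: geodesic_line_def)
  have dist: "1 + point_pair (c 0) (c t) / 2 = cosh t" if "t \<ge> 0" for t
  proof -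
    have "hyp_dist (c 0) (c t) = t"
      using assms(2) that by (simp add: geodesic_line_def)
    then show ?thesis unfolding hyp_dist_point_pair
      using cosh_arcosh_real[of "1 + point_pair (c 0) (c t) / 2"] point_pair_nonneg[OF H H, of 0 t]
      by auto
  qed
  have d2: "det (M ** M) = 1" using assms(1) by (simp add: det_mul)
  have "moebius (M ** M) (c 0) = c (2 * l)"
    using assms(1) H by (simp add: moebius_mult assms(4))
  then have "point_pair (c 0) (c (2 * l)) = (trace M)\<^sup>2 * point_pair (c 0) (c l)"
    using point_pair_displacement[OF d2 H[of 0]] point_pair_displacement[OF assms(1) H[of 0]] assms(4)[of 0]
    by (simp add: fixed_form_square norm_mult power_mult_distrib)
  moreover have "point_pair (c 0) (c l) = 2 * (cosh l - 1)"
      "point_pair (c 0) (c (2 * l)) = 2 * (cosh (2 * l) - 1)"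
    using dist[of l] dist[of "2 * l"] \<open>l > 0\<close> by simp_all
  ultimately have "2 * (cosh (2 * l) - 1) = 2 * ((trace M)\<^sup>2 * (cosh l - 1))"
    by (metis mult.left_commute)
  then have "cosh (2 * l) - 1 = (trace M)\<^sup>2 * (cosh l - 1)"
    by (simp only: mult_cancel_left) simp
  moreover have "cosh (2 * l) - 1 = 2 * (cosh l + 1) * (cosh l - 1)"
    unfolding cosh_double_cosh by (simp add: algebra_simps power2_eq_square)
  moreover have "cosh l \<noteq> 1" using \<open>l > 0\<close>
    by (metis cosh_0 cosh_real_nonneg_less_iff less_irrefl order_refl less_imp_le)
  ultimately have "(trace M)\<^sup>2 = 2 * (cosh l + 1)" by simp
  also have "\<dots> = (2 * cosh (l / 2))\<^sup>2"
    using cosh_double_cosh[of "l / 2"] by (simp add: power2_eq_square)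
  finally show ?thesis
    by (metis abs_of_nonneg cosh_real_nonneg mult_nonneg_nonneg power2_eq_iff_nonneg abs_ge_zero power2_abs zero_le_numeral)
qed

lemma add_inverse_gt_2_cases:
  assumes "t > (2::real)"
  obtains l where "l > 1" "t = l + 1 / l"
proof -
  define l where "l = (t + sqrt (t\<^sup>2 - 4)) / 2"
  have t: "t\<^sup>2 > 4" using assms power_strict_mono[of 2 t 2] by simp
  then have "sqrt (t\<^sup>2 - 4) > 0" by simp
  with assms have "2 < t + sqrt (t\<^sup>2 - 4)" by (metis add_strict_mono add.right_neutral)
  then have "l > 1" by (simp add: l_def)
  have "l * (t - l) = 1"
    using t unfolding l_def by (simp add: field_simps power2_eq_square)
  then have "1 / l = (l * (t - l)) / l" by simp
  also have "\<dots> = t - l" using \<open>l > 1\<close> by simp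
  finally have "t = l + 1 / l" by simp
  with \<open>l > 1\<close> show ?thesis by (rule that)
qed

text \<open>The columns of \<open>g\<close> are eigenvectors for \<open>l\<close> and
  \<open>1 / l\<close>; which formula yields independent ones depends on the off-diagonal entry of
  \<open>M\<close> that is nonzero.\<close>

lemma hyperbolic_diagonalise_pos:
  assumes "det M = 1" "trace M > 2"
  obtains g l where "det g = 1" "l > 1" "M ** g = g ** mat2 l 0 0 (1 / l)"
proof (cases M)
  case (1 a b c d)
  obtain l where l: "l > 1" "trace M = l + 1 / l"
    using add_inverse_gt_2_cases assms(2) by blast
  define m where "m = 1 / l"
  have lm: "l * m = 1" "l \<noteq> m" "a + d = l + m" "a * d - b * c = 1"
    using l assms by (auto simp: m_def 1 field_simps)
      (metis l(1) less_1_mult less_numeral_extra(4))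
  have "\<exists>p q r s. p * s - q * r \<noteq> 0 \<and> M ** mat2 p q r s = mat2 p q r s ** mat2 l 0 0 m"
  proof -
    consider "c \<noteq> 0" | "c = 0" "b \<noteq> 0" | "c = 0" "b = 0" "a = l" | "c = 0" "b = 0" "a \<noteq> l" by blast
    then show ?thesis
    proof cases
      case c0: 1
      have "(l - d) * c - (m - d) * c \<noteq> 0" using lm c0 by (simp add: algebra_simps)
      moreover have "M ** mat2 (l - d) (m - d) c c = mat2 (l - d) (m - d) c c ** mat2 l 0 0 m"
        using lm by (simp add: 1) algebra
      ultimately show ?thesis by blast
    next
      case 2
      have "b * (m - a) - b * (l - a) \<noteq> 0" using lm 2 by (simp add: algebra_simps)
      moreover have "M ** mat2 b b (l - a) (m - a) = mat2 b b (l - a) (m - a) ** mat2 l 0 0 m"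
        using lm by (simp add: 1) algebra
      ultimately show ?thesis by blast
    next
      case 3
      then have "M ** mat2 1 0 0 1 = mat2 1 0 0 1 ** mat2 l 0 0 m" using lm by (simp add: 1)
      then show ?thesis by (metis mult_1 mult_zero_left diff_zero zero_neq_one)
    next
      \<comment> \<open>Here \<open>M\<close> is diagonal with its eigenvalues in the wrong order,
        and a quarter turn swaps them.\<close>
      case 4
      have "(a - l) * (a - m) = 0" using lm 4 by algebra
      with 4 have "a = m" "d = l" using lm by auto
      then have "M ** mat2 0 (- 1) 1 0 = mat2 0 (- 1) 1 0 ** mat2 l 0 0 m" using 4 by (simp add: 1)
      moreover have "0 * 0 - (- 1) * 1 \<noteq> (0::real)" by simp
      ultimately show ?thesis by blast
    qed
  qed
  then obtain p q r s where g: "p * s - q * r \<noteq> 0"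
      "M ** mat2 p q r s = mat2 p q r s ** mat2 l 0 0 m" by blast
  \<comment> \<open>Dividing only the first column by the determinant keeps both columns
    eigenvectors and makes the determinant 1.\<close>
  define e where "e = p * s - q * r"
  show ?thesis
  proof
    have "p / e * s - q * (r / e) = (p * s - q * r) / e" by (simp add: diff_divide_distrib)
    then show "det (mat2 (p / e) q (r / e) s) = 1" using g(1) by (simp add: e_def)
    show "l > 1" by (rule l)
    have e: "e \<noteq> 0" using g(1) by (simp add: e_def)
    have "a * p + b * r = p * l" "a * q + b * s = q * m" "c * p + d * r = r * l" "c * q + d * s = s * m"
      using g(2) by (auto simp: 1)
    then show "M ** mat2 (p / e) q (r / e) s = mat2 (p / e) q (r / e) s ** mat2 l 0 0 (1 / l)"
      using e by (simp add: 1 m_def[symmetric] add_divide_distrib[symmetric])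
  qed
qed

lemma hyp_dist_moebius:
  assumes "det M = 1" "z \<in> upper_halfplane" "w \<in> upper_halfplane"
  shows "hyp_dist (moebius M z) (moebius M w) = hyp_dist z w"
  using assms by (simp add: hyp_dist_point_pair point_pair_moebius)

lemma geodesic_line_imaginary_axis: "geodesic_line (\<lambda>t. \<i> * of_real (exp t))"
proof -
  have "hyp_dist (\<i> * of_real (exp s)) (\<i> * of_real (exp t)) = \<bar>s - t\<bar>" for s t
  proof -
    have "\<i> * of_real (exp s) - \<i> * of_real (exp t) = \<i> * of_real (exp s - exp t)"
      by (simp add: algebra_simps)
    then have "cmod (\<i> * of_real (exp s) - \<i> * of_real (exp t)) = \<bar>exp s - exp t\<bar>"
      by (simp only: norm_mult norm_of_real norm_ii mult_1)
    then have "1 + point_pair (\<i> * of_real (exp s)) (\<i> * of_real (exp t)) / 2 = cosh (s - t)"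
      unfolding point_pair_def
      by (simp add: cosh_field_def exp_diff field_simps power2_eq_square exp_minus)
    also have "\<dots> = cosh \<bar>s - t\<bar>" by simp
    finally show ?thesis unfolding hyp_dist_point_pair
      by (simp only: arcosh_cosh_real abs_ge_zero)
  qed
  then show ?thesis by (simp add: geodesic_line_def upper_halfplane_def)
qed

lemma geodesic_line_moebius:
  assumes "det M = 1" "geodesic_line c"
  shows "geodesic_line (\<lambda>t. moebius M (c t))"
  using assms unfolding geodesic_line_def
  by (simp add: hyp_dist_moebius moebius_upper_halfplane)

lemma exists_axis_pos:
  assumes "det M = 1" "trace M > 2"
  obtains c l where "l > 0" "geodesic_line c" "\<And>t. moebius M (c t) = c (t + l)"
proof -
  obtain g k where g: "det g = 1" "k > 1" "M ** g = g ** mat2 k 0 0 (1 / k)"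
    using hyperbolic_diagonalise_pos[OF assms] .
  define c where "c = (\<lambda>t. moebius g (\<i> * of_real (exp t)))"
  have H: "\<i> * of_real (exp t) \<in> upper_halfplane" for t by (simp add: upper_halfplane_def)
  \<comment> \<open>The diagonal matrix with entries \<open>k\<close> and \<open>1 / k\<close>
    multiplies by \<open>k\<^sup>2\<close>, hence the factor 2.\<close>
  have "moebius M (c t) = c (t + 2 * ln k)" for t
  proof -
    have "moebius M (c t) = moebius (M ** g) (\<i> * of_real (exp t))"
      unfolding c_def by (rule moebius_mult[symmetric, OF g(1) H])
    also have "\<dots> = moebius g (moebius (mat2 k 0 0 (1 / k)) (\<i> * of_real (exp t)))"
      unfolding g(3) by (rule moebius_mult[OF _ H]) (use g in auto)
    also have "moebius (mat2 k 0 0 (1 / k)) (\<i> * of_real (exp t)) = \<i> * of_real (exp (t + 2 * ln k))"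
    proof -
      have "exp (2 * ln k) = k\<^sup>2" using g(2) by (simp add: exp_of_nat_mult[of 2, simplified])
      then show ?thesis using g(2) by (simp add: moebius_mat2 exp_add power2_eq_square)
    qed
    finally show ?thesis by (simp add: c_def)
  qed
  moreover have "geodesic_line c"
    unfolding c_def by (rule geodesic_line_moebius[OF g(1) geodesic_line_imaginary_axis])
  moreover have "2 * ln k > 0" using g(2) by simp
  ultimately show ?thesis using that by blast
qed

text \<open>The definite description in \<open>geodesic_length\<close> needs existence and
  uniqueness. An axis exists for whichever of \<open>M\<close> and \<open>- M\<close> has positive
  trace, both being the same Moebius map; the length is unique because the trace fixes
  \<open>cosh (l / 2)\<close>.\<close>

lemma Tr_eq_abs_trace:
  assumes "\<rho> \<gamma> = {M, - M}" "det M = 1" "\<bar>trace M\<bar> > 2"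
  shows "Tr \<rho> \<gamma> = \<bar>trace M\<bar>"
proof -
  let ?P = "\<lambda>l. l > 0 \<and> (\<exists>c. geodesic_line c \<and> (\<forall>M\<in>\<rho> \<gamma>. \<forall>t. moebius M (c t) = c (t + l)))"
  have *: "\<bar>trace M\<bar> = 2 * cosh (l / 2)" if "?P l" for l
    using that translation_length_trace[OF assms(2)] assms(1) by blast
  obtain N where N: "N \<in> {M, - M}" "trace N > 2"
    using assms(3) that[of M] that[of "- M"] by (cases "trace M > 0") auto
  then have "det N = 1" using assms(2) by auto
  then obtain c l where "l > 0" "geodesic_line c" "\<And>t. moebius N (c t) = c (t + l)"
    using exists_axis_pos N(2) by blast
  then have l: "?P l" using N(1) assms(1) by fastforce
  have "(THE l. ?P l) = l"
  proof (rule the_equality[where P = ?P, OF l])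
    fix l' assume l': "?P l'"
    then have "cosh (l' / 2) = cosh (l / 2)" using *[OF l] *[OF l'] by simp
    then show "l' = l" using l l'
      by (smt (verit, best) cosh_real_nonneg_less_iff field_sum_of_halves)
  qed
  then show ?thesis using *[OF l] by (simp add: Tr_def geodesic_length_def)
qed

section \<open>Elliptic and parabolic elements\<close>

text \<open>\<open>fixed_form M\<close> is a real quadratic with discriminant
  \<open>(trace M)\<^sup>2 - 4 < 0\<close>, so one of its two conjugate roots lies in the upper
  half-plane.\<close>

lemma elliptic_fixed_point:
  assumes "det M = 1" "\<bar>trace M\<bar> < 2"
  shows "\<exists>z\<in>upper_halfplane. moebius M z = z"
proof (cases M)
  case (1 a b c d)
  define D where "D = 4 - (a + d)\<^sup>2"
  have "D > 0" using assms(2) abs_square_less_1[of "(a + d) / 2"]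
    by (simp add: 1 D_def power_divide)
  have det: "a * d - b * c = 1" using assms by (simp add: 1)
  have "c \<noteq> 0"
  proof
    assume "c = 0"
    then have "D = - ((a - d)\<^sup>2)" using det unfolding D_def by (simp add: power2_eq_square algebra_simps)
    with \<open>D > 0\<close> show False by (smt (verit) zero_le_power2)
  qed
  \<comment> \<open>The quadratic formula; the absolute value of \<open>c\<close> selects the root
    with positive imaginary part.\<close>
  define z where "z = Complex ((a - d) / (2 * c)) (sqrt D / (2 * \<bar>c\<bar>))"
  have z: "z \<in> upper_halfplane"
    using \<open>D > 0\<close> \<open>c \<noteq> 0\<close> by (simp add: z_def upper_halfplane_def)
  have im2: "(sqrt D / (2 * \<bar>c\<bar>))\<^sup>2 = D / (4 * c\<^sup>2)"
    using \<open>D > 0\<close> by (simp add: power_divide power_mult_distrib)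
  have "Re (fixed_form M z) = c * ((Re z)\<^sup>2 - (Im z)\<^sup>2) + (d - a) * Re z - b"
    by (simp add: 1 fixed_form_def power2_eq_square)
  also have "\<dots> = (a * d - b * c - 1) / c"
  proof -
    have I: "(Im z)\<^sup>2 = (4 - (a + d)\<^sup>2) / (4 * c\<^sup>2)" using im2 by (simp add: z_def D_def)
    have R: "Re z = (a - d) / (2 * c)" by (simp add: z_def)
    show ?thesis unfolding I R using \<open>c \<noteq> 0\<close> by (simp add: field_simps power2_eq_square)
  qed
  also have "\<dots> = 0" using det by simp
  finally have "Re (fixed_form M z) = 0" .
  moreover have "Im (fixed_form M z) = (2 * c * Re z + (d - a)) * Im z"
    by (simp add: 1 fixed_form_def power2_eq_square algebra_simps)
  then have "Im (fixed_form M z) = 0" using \<open>c \<noteq> 0\<close> by (simp add: z_def)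
  ultimately have "fixed_form M z = 0" by (simp add: complex_eq_iff)
  then show ?thesis using z moebius_fixed_iff[OF assms(1) z] by blast
qed

text \<open>The identity plus \<open>s\<close> times the product of the column
  \<open>(- q, p)\<close> with the row \<open>(p, q)\<close>. The fixed point on the boundary is
  \<open>- q / p\<close>, or infinity for \<open>p = 0\<close> and nonzero \<open>q\<close>.\<close>

definition unipotent :: "real \<Rightarrow> real \<Rightarrow> real \<Rightarrow> real^2^2"
  where "unipotent s p q = mat2 (1 - s * p * q) (- s * q\<^sup>2) (s * p\<^sup>2) (1 + s * p * q)"

text \<open>Determinant 1 and trace 2 make the discriminant of \<open>fixed_form M\<close> vanish,
  so the form is a perfect square up to the sign \<open>s\<close>. If \<open>c\<close> is nonzero,
  \<open>p\<close> is the root of its absolute value and the middle coefficient gives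
  \<open>q\<close>.\<close>

lemma unipotent_cases:
  assumes "det M = 1" "trace M = 2"
  obtains s p q where "\<bar>s\<bar> = 1" "M = unipotent s p q"
proof (cases M)
  case (1 a b c d)
  have tr: "a + d = 2" and det: "a * d - b * c = 1" using assms by (simp_all add: 1)
  have "(d - a)\<^sup>2 = (a + d)\<^sup>2 - 4 * (a * d - b * c) - 4 * b * c"
    by (simp add: power2_eq_square algebra_simps)
  then have disc: "(d - a)\<^sup>2 = - 4 * b * c" unfolding tr det by simp
  show ?thesis
  proof (cases "c = 0")
    case True
    then have "a = d" using disc by simp
    then have "a = 1" "d = 1" using tr by auto
    then have "M = unipotent (- sgn b) 0 (sqrt \<bar>b\<bar>)" if "b \<noteq> 0"
      using True that by (simp add: 1 unipotent_def sgn_if)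
    moreover have "M = unipotent 1 0 0" if "b = 0"
      using True that \<open>a = 1\<close> \<open>d = 1\<close> by (simp add: 1 unipotent_def)
    ultimately show ?thesis using that
      by (metis abs_minus_cancel abs_one abs_sgn_eq_1)
  next
    case False
    define p where "p = sqrt \<bar>c\<bar>"
    have p: "p \<noteq> 0" "p\<^sup>2 = \<bar>c\<bar>" using False by (auto simp: p_def)
    define s where "s = sgn c"
    have s: "s * s = 1" "\<bar>s\<bar> = 1" "s * p\<^sup>2 = c"
      using False p by (auto simp: s_def sgn_if)
    define q where "q = s * (d - a) / (2 * p)"
    have pq: "2 * (p * q) = s * (d - a)" using p by (simp add: q_def)
    then have spq: "2 * (s * p * q) = d - a" using s(1) by algebra
    have "4 * p\<^sup>2 * q\<^sup>2 = (d - a)\<^sup>2" using pq s(1) by algebra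
    then have "p\<^sup>2 * (s * q\<^sup>2 + b) = 0" using disc s(1,3) by algebra
      then have "s * q\<^sup>2 = - b" using p False by simp
    then have "M = unipotent s p q"
      using spq tr s(3) by (simp add: 1 unipotent_def)
    then show ?thesis using that s(2) by blast
  qed
qed

lemma fixed_form_unipotent: "fixed_form (unipotent s p q) z = of_real s * (of_real p * z + of_real q)\<^sup>2"
  by (simp add: fixed_form_def unipotent_def algebra_simps power2_eq_square)

text \<open>Approach the boundary fixed point vertically. For \<open>p = 0\<close> the form is
  constant while the height grows; otherwise at height \<open>t\<close> above \<open>- q / p\<close>
  the form has size \<open>p\<^sup>2 * t\<^sup>2\<close>.\<close>

lemma unipotent_small_displacement:
  assumes "\<bar>s\<bar> = 1" "e > 0"
  shows "\<exists>z\<in>upper_halfplane. cmod (fixed_form (unipotent s p q) z) < e * Im z"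
proof (cases "p = 0")
  case True
  let ?T = "q\<^sup>2 / e + 1"
  have T: "?T > 0" "q\<^sup>2 < e * ?T" using assms by (auto simp: field_simps add_pos_nonneg)
  show ?thesis
    by (rule bexI[of _ "Complex 0 ?T"])
      (use T assms True in \<open>auto simp: upper_halfplane_def fixed_form_unipotent norm_mult norm_power\<close>)
next
  case False
  define t where "t = e / (p\<^sup>2 + 1)"
  have p1: "p\<^sup>2 + 1 > 0" by (simp add: add_nonneg_pos)
  have t: "t > 0" "p\<^sup>2 * t < e"
    using assms p1 by (auto simp: t_def field_simps)
  have "of_real p * Complex (- q / p) t + of_real q = Complex 0 (p * t)"
    using False by (simp add: complex_eq_iff)
  then have "cmod (fixed_form (unipotent s p q) (Complex (- q / p) t)) = (cmod (Complex 0 (p * t)))\<^sup>2"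
    using assms by (simp add: fixed_form_unipotent norm_mult norm_power)
  also have "\<dots> = (p\<^sup>2 * t) * t" unfolding cmod_power2 by (simp add: power2_eq_square)
  also have "\<dots> < e * t" using t by (intro mult_strict_right_mono)
  finally show ?thesis using t
    by (intro bexI[of _ "Complex (- q / p) t"]) (auto simp: upper_halfplane_def)
qed

lemma dist_mat2_le:
  "dist (mat2 a b c d) (mat2 a' b' c' d') \<le> \<bar>a - a'\<bar> + \<bar>b - b'\<bar> + \<bar>c - c'\<bar> + \<bar>d - d'\<bar>"
proof -
  let ?M = "mat2 a b c d - mat2 a' b' c' d'"
  have "norm (vec_nth ?M i) \<le> \<bar>vec_nth (vec_nth ?M i) 1\<bar> + \<bar>vec_nth (vec_nth ?M i) 2\<bar>" for i
    using norm_le_l1_cart[of "vec_nth ?M i"] by (simp add: sum_2)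
  moreover have "norm ?M \<le> norm (vec_nth ?M 1) + norm (vec_nth ?M 2)"
    unfolding norm_vec_def L2_set_def sum_2
    by (rule order_trans[OF sqrt_add_le_add_sqrt]) auto
  ultimately have "norm ?M \<le> (\<bar>vec_nth (vec_nth ?M 1) 1\<bar> + \<bar>vec_nth (vec_nth ?M 1) 2\<bar>) +
      (\<bar>vec_nth (vec_nth ?M 2) 1\<bar> + \<bar>vec_nth (vec_nth ?M 2) 2\<bar>)"
    by (meson add_mono order_trans)
  then show ?thesis by (simp add: dist_norm)
qed

text \<open>The modulus of the form is \<open>(p * Re z + q)\<^sup>2 + (p * Im z)\<^sup>2\<close>,
  so a small value at a point neither near the real line nor far away makes \<open>p\<close> and
  \<open>q\<close> small. The factor depends only on \<open>B\<close> and \<open>v\<close>, hence is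
  uniform on a compact set.\<close>

lemma dist_unipotent_le:
  assumes "\<bar>s\<bar> = 1" "cmod z \<le> B" "v > 0" "v \<le> Im z"
  shows "dist (mat 1) (unipotent s p q)
    \<le> 2 * (2 * (1 + B\<^sup>2 / v\<^sup>2) + 1 / v\<^sup>2) * cmod (fixed_form (unipotent s p q) z)"
proof -
  define Q where "Q = cmod (fixed_form (unipotent s p q) z)"
  have Q: "Q = (p * Re z + q)\<^sup>2 + (p * Im z)\<^sup>2"
    using assms(1) by (simp add: Q_def fixed_form_unipotent norm_mult norm_power cmod_power2)
  have "Q \<ge> 0" by (simp add: Q_def)
  have "p\<^sup>2 * v\<^sup>2 \<le> p\<^sup>2 * (Im z)\<^sup>2"
    using assms by (intro mult_left_mono power_mono) auto
  then have p: "p\<^sup>2 \<le> Q / v\<^sup>2"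
    using assms Q by (simp add: field_simps power_mult_distrib) (smt (verit) zero_le_power2)
  have "q\<^sup>2 = ((p * Re z + q) - p * Re z)\<^sup>2" by simp
  also have "\<dots> \<le> 2 * (p * Re z + q)\<^sup>2 + 2 * (p * Re z)\<^sup>2"
    using zero_le_power2[of "(p * Re z + q) + p * Re z"] by (simp add: power2_eq_square algebra_simps)
  also have "(p * Re z)\<^sup>2 \<le> (Q / v\<^sup>2) * B\<^sup>2"
  proof -
    have "\<bar>Re z\<bar> \<le> B" using abs_Re_le_cmod[of z] assms by linarith
    then have "(Re z)\<^sup>2 \<le> B\<^sup>2" by (metis abs_ge_zero power2_abs power_mono)
    then show ?thesis unfolding power_mult_distrib
      using p \<open>Q \<ge> 0\<close> by (intro mult_mono) auto
  qed
  also have "(p * Re z + q)\<^sup>2 \<le> Q" using Q by simp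
  finally have q: "q\<^sup>2 \<le> 2 * Q + 2 * (Q / v\<^sup>2 * B\<^sup>2)" by simp
  have "dist (mat 1) (unipotent s p q) \<le> 2 * \<bar>p * q\<bar> + p\<^sup>2 + q\<^sup>2"
    using dist_mat2_le[of 1 0 0 1 "1 - s * p * q" "- s * q\<^sup>2" "s * p\<^sup>2" "1 + s * p * q"] assms(1)
    by (simp add: mat_mat2 unipotent_def abs_mult)
  also have "2 * \<bar>p * q\<bar> \<le> p\<^sup>2 + q\<^sup>2"
    using zero_le_power2[of "\<bar>p\<bar> - \<bar>q\<bar>"] by (simp add: power2_eq_square algebra_simps abs_mult)
  also have "p\<^sup>2 + q\<^sup>2 + p\<^sup>2 + q\<^sup>2 \<le> 2 * (Q / v\<^sup>2 + (2 * Q + 2 * (Q / v\<^sup>2 * B\<^sup>2)))"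
    using add_mono[OF p q] by simp
  also have "\<dots> = 2 * (2 * (1 + B\<^sup>2 / v\<^sup>2) + 1 / v\<^sup>2) * Q"
    by (simp add: algebra_simps)
  finally show ?thesis by (simp add: Q_def)
qed

text \<open>A parabolic element would displace some points by arbitrarily little; moved into a compact
  fundamental set, it yields group elements accumulating at the identity.\<close>

lemma cocompact_no_parabolic:
  fixes G :: "(real^2^2) set"
  assumes det: "\<And>M. M \<in> G \<Longrightarrow> det M = 1"
    and one: "mat 1 \<in> G"
    and mult: "\<And>M N. M \<in> G \<Longrightarrow> N \<in> G \<Longrightarrow> M ** N \<in> G"
    and inv: "\<And>M. M \<in> G \<Longrightarrow> \<exists>N\<in>G. M ** N = mat 1 \<and> N ** M = mat 1"
    and disc: "discrete G"
    and K: "compact K" "K \<subseteq> upper_halfplane"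
    and cover: "\<And>z. z \<in> upper_halfplane \<Longrightarrow> \<exists>M\<in>G. moebius M z \<in> K"
    and M: "M \<in> G" "trace M = 2"
  shows "M = mat 1"
proof -
  obtain e where e: "e > 0" "\<And>N. N \<in> G \<Longrightarrow> dist (mat 1) N < e \<Longrightarrow> N = mat 1"
    using disc one unfolding discrete_def isolated_in_dist_Ex_iff by blast
  obtain B where B: "B > 0" "\<And>z. z \<in> K \<Longrightarrow> cmod z \<le> B"
    using compact_imp_bounded[OF K(1)] by (auto simp: bounded_pos)
  obtain v where v: "v > 0" "\<And>z. z \<in> K \<Longrightarrow> v \<le> Im z"
  proof (cases "K = {}")
    case True
    then show ?thesis using that[of 1] by auto
  next
    case False
    then obtain x where "x \<in> K" "\<forall>y\<in>K. Im x \<le> Im y"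
      using continuous_attains_inf[OF K(1), of Im] continuous_on_Im[OF continuous_on_id] by blast
    then show ?thesis using that[of "Im x"] K(2) by (auto simp: upper_halfplane_def)
  qed
  define C where "C = 2 * (2 * (1 + B\<^sup>2 / v\<^sup>2) + 1 / v\<^sup>2)"
  have C: "C > 0" using v(1) by (simp add: C_def add_pos_nonneg add_pos_pos)
  \<comment> \<open>Chosen so that \<open>C * (h * B) = e\<close>; the factor \<open>B\<close>
    bounds the height of points of \<open>K\<close>.\<close>
  define h where "h = e / (C * B)"
  have h: "h > 0" using e C B by (simp add: h_def)
  obtain s p q where "\<bar>s\<bar> = 1" "M = unipotent s p q"
    using unipotent_cases[OF det[OF M(1)] M(2)] by blast
  then obtain z where z: "z \<in> upper_halfplane" "cmod (fixed_form M z) < h * Im z"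
    using unipotent_small_displacement[OF _ h] by blast
  obtain g where g: "g \<in> G" "moebius g z \<in> K" using cover[OF z(1)] by blast
  obtain g' where g': "g' \<in> G" "g ** g' = mat 1" "g' ** g = mat 1" using inv[OF g(1)] by blast
  define w where "w = moebius g z"
  \<comment> \<open>The conjugate displaces \<open>w\<close>, a point of \<open>K\<close>, exactly
    as far as \<open>M\<close> displaces \<open>z\<close>, and it is again unipotent.\<close>
  define N where "N = g ** M ** g'"
  have N: "N \<in> G" using M g g' by (simp add: N_def mult)
  have "trace N = trace (g' ** (g ** M))" unfolding N_def by (rule trace_mul_sym)
  then have tr: "trace N = 2" using M(2) g'(3) by (simp add: matrix_mul_assoc)
  have w: "w \<in> upper_halfplane" using K(2) g(2) by (auto simp: w_def)
  have "N ** g = g ** M" unfolding N_def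
    by (metis g'(3) matrix_mul_assoc matrix_mul_rid)
  then have "moebius N w = moebius g (moebius M z)"
    unfolding w_def using moebius_mult z(1) det[OF g(1)] det[OF M(1)] by metis
  then have "point_pair w (moebius N w) = point_pair z (moebius M z)"
    unfolding w_def using point_pair_moebius det[OF g(1)] det[OF M(1)] z(1)
    by (simp add: moebius_upper_halfplane)
  then have "(cmod (fixed_form N w) / Im w)\<^sup>2 = (cmod (fixed_form M z) / Im z)\<^sup>2"
    using point_pair_displacement det[OF N] det[OF M(1)] w z(1) by (simp add: power_divide)
  then have "cmod (fixed_form N w) / Im w = cmod (fixed_form M z) / Im z"
    using w z(1) by (subst (asm) power2_eq_iff_nonneg) (auto simp: upper_halfplane_def)
  also have "\<dots> < h" using z by (simp add: field_simps upper_halfplane_def)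
  finally have *: "cmod (fixed_form N w) < h * Im w" using w by (simp add: field_simps upper_halfplane_def)
  have wK: "w \<in> K" using g(2) by (simp add: w_def)
  have "Im w \<le> B" using B(2)[OF wK] abs_Im_le_cmod[of w] by linarith
  then have "h * Im w \<le> h * B" using h by simp
  with * have **: "cmod (fixed_form N w) < h * B" by linarith
  obtain s p q where N': "\<bar>s\<bar> = 1" "N = unipotent s p q"
    using unipotent_cases[OF det[OF N] tr] by blast
  have "dist (mat 1) N \<le> C * cmod (fixed_form N w)"
    unfolding C_def N'(2) by (rule dist_unipotent_le) (use N' B v wK in auto)
  also have "\<dots> < C * (h * B)" using C ** by simp
  also have "\<dots> = e" using C B by (simp add: h_def)
  finally have "N = mat 1" using e(2) N by blast
  with \<open>N ** g = g ** M\<close> have "g ** M = g" by simp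
  then show "M = mat 1" by (metis g'(3) matrix_mul_assoc matrix_mul_lid)
qed

section \<open>Lifts of the holonomy representation\<close>

lemma carrier_PSL2R: "X \<in> carrier PSL2R \<longleftrightarrow> (\<exists>M. det M = 1 \<and> X = {M, - M})"
proof -
  have "- mat 1 ** M = - M" for M :: "real^2^2" by (cases M) (simp add: mat_mat2)
  then show ?thesis
    by (auto simp: PSL2R_def FactGroup_def RCOSETS_def r_coset_def SL2R_def)
qed

lemma mult_PSL2R: "{M, - M} \<otimes>\<^bsub>PSL2R\<^esub> {N, - N} = {M ** N, - (M ** N)}"
proof -
  have "- M ** N = - (M ** N)" "M ** - N = - (M ** N)" "- M ** - N = M ** N"
    by (cases M; cases N; simp)+
  then show ?thesis
    by (auto simp: PSL2R_def FactGroup_def set_mult_def SL2R_def)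
qed

lemma one_PSL2R: "\<one>\<^bsub>PSL2R\<^esub> = {mat 1, - mat 1}"
  by (simp add: PSL2R_def FactGroup_def)

text \<open>A coordinate of the abelianisation: well defined because the relator is a product of
  commutators, and enough to see that a class is nontrivial. It vanishes on \<open>gamma 7\<close>,
  which therefore needs another treatment.\<close>

definition exponent_sum :: "surface_gen \<Rightarrow> surface_word \<Rightarrow> int"
  where "exponent_sum s w = (\<Sum>(t, e)\<leftarrow>w. if t = s then (if e then 1 else - 1) else 0)"

lemma exponent_sum_surface_eq: "surface_eq u v \<Longrightarrow> exponent_sum s u = exponent_sum s v"
  by (induction rule: surface_eq.induct) (auto simp: exponent_sum_def)

lemma surface_class_nontrivial:
  assumes "exponent_sum s w \<noteq> 0"
  shows "surface_class w \<noteq> \<one>\<^bsub>surface_group\<^esub>"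
proof
  assume "surface_class w = \<one>\<^bsub>surface_group\<^esub>"
  then have "surface_eq w []" by (simp add: surface_group_def surface_class_eq_iff)
  from exponent_sum_surface_eq[OF this, of s] assms show False by (simp add: exponent_sum_def)
qed

lemma surface_class_carrier [simp]: "surface_class w \<in> carrier surface_group"
  by (simp add: surface_group_def)

lemma surface_one: "\<one>\<^bsub>surface_group\<^esub> = surface_class []"
  by (simp add: surface_group_def)

locale holonomy =
  fixes \<rho> :: "surface_word set \<Rightarrow> (real^2^2) set"
  assumes hyperbolic: "hyperbolic_metric \<rho>"
begin

abbreviation lifts :: "surface_word \<Rightarrow> (real^2^2) set"
  where "lifts w \<equiv> \<rho> (surface_class w)"

lemma hom: "group_hom surface_group PSL2R \<rho>"
  using hyperbolic group_surface_group group_PSL2R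
  by (simp add: hyperbolic_metric_def group_hom_def group_hom_axioms_def)

lemma lift_cases:
  assumes "M \<in> \<rho> \<gamma>" "\<gamma> \<in> carrier surface_group"
  shows "det M = 1" "\<rho> \<gamma> = {M, - M}"
proof -
  have "\<rho> \<gamma> \<in> carrier PSL2R" using group_hom.hom_closed[OF hom] assms(2) by blast
  then obtain N where N: "det N = 1" "\<rho> \<gamma> = {N, - N}"
    unfolding carrier_PSL2R by blast
  have "M \<in> {N, - N}" using assms(1) unfolding N(2) .
  then consider "M = N" | "M = - N" by blast
  then have "det M = 1 \<and> {N, - N} = {M, - M}"
    by cases (use N(1) in \<open>simp_all add: insert_commute\<close>)
  then show "det M = 1" "\<rho> \<gamma> = {M, - M}" unfolding N(2) by blast+
qed

lemma lift_exists:
  assumes "\<gamma> \<in> carrier surface_group"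
  obtains M where "M \<in> \<rho> \<gamma>"
  using group_hom.hom_closed[OF hom assms] that unfolding carrier_PSL2R by blast

lemma lift_uminus: "M \<in> \<rho> \<gamma> \<Longrightarrow> \<gamma> \<in> carrier surface_group \<Longrightarrow> - M \<in> \<rho> \<gamma>"
  using lift_cases(2) by blast

lemma lift_mult:
  assumes "M \<in> \<rho> \<gamma>" "N \<in> \<rho> \<delta>" "\<gamma> \<in> carrier surface_group" "\<delta> \<in> carrier surface_group"
  shows "M ** N \<in> \<rho> (\<gamma> \<otimes>\<^bsub>surface_group\<^esub> \<delta>)"
proof -
  have "\<rho> (\<gamma> \<otimes>\<^bsub>surface_group\<^esub> \<delta>) = \<rho> \<gamma> \<otimes>\<^bsub>PSL2R\<^esub> \<rho> \<delta>"
    using group_hom.hom_mult[OF hom] assms by blast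
  also have "\<dots> = {M ** N, - (M ** N)}"
    using lift_cases[OF assms(1,3)] lift_cases[OF assms(2,4)] mult_PSL2R by metis
  finally show ?thesis by simp
qed

lemma lifts_append: "M \<in> lifts u \<Longrightarrow> N \<in> lifts v \<Longrightarrow> M ** N \<in> lifts (u @ v)"
  using lift_mult[of M "surface_class u" N "surface_class v"] by (simp add: surface_mult_class)

lemma lifts_Nil: "lifts [] = {mat 1, - mat 1}"
  using group_hom.hom_one[OF hom] by (simp add: surface_one one_PSL2R)

text \<open>Any lift of the inverse letter is \<open>N\<close> or \<open>- N\<close>, and lifts come
  in such pairs, so the exact matrix inverse is a lift.\<close>

lemma lift_inverse:
  assumes "M \<in> lifts [(s, e)]" "N ** M = mat 1"
  shows "N \<in> lifts [(s, \<not> e)]"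
proof -
  obtain L where L: "L \<in> lifts [(s, \<not> e)]" using lift_exists surface_class_carrier by blast
  have "L ** M \<in> lifts ([(s, \<not> e)] @ [(s, e)])" using lifts_append L assms(1) by blast
  moreover have "surface_class ([(s, \<not> e)] @ [(s, e)]) = surface_class []"
    using surface_eq.cancel[of s "\<not> e"] by (simp add: surface_class_eq_iff)
  ultimately have "L ** M \<in> {mat 1, - mat 1}" using lifts_Nil by simp
  have *: "M ** N = mat 1" using assms(2) by (simp add: matrix_left_right_inverse)
  from \<open>L ** M \<in> {mat 1, - mat 1}\<close> have "L ** M ** N = N \<or> L ** M ** N = - N"
    by (cases N) (auto simp: mat_mat2)
  then have "L = N \<or> L = - N" using * by (metis matrix_mul_assoc matrix_mul_rid)
  then show ?thesis using L lift_uminus[OF L] by auto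
qed

abbreviation image_lifts :: "(real^2^2) set"
  where "image_lifts \<equiv> \<Union>(\<rho> ` carrier surface_group)"

lemma image_liftsI: "M \<in> \<rho> \<gamma> \<Longrightarrow> \<gamma> \<in> carrier surface_group \<Longrightarrow> M \<in> image_lifts"
  by (rule UnionI[OF imageI])

lemma image_liftsE:
  assumes "M \<in> image_lifts"
  obtains \<gamma> where "M \<in> \<rho> \<gamma>" "\<gamma> \<in> carrier surface_group"
  using assms by (elim UnionE imageE) simp

lemma fixed_point_free:
  assumes "\<gamma> \<in> carrier surface_group" "\<gamma> \<noteq> \<one>\<^bsub>surface_group\<^esub>" "M \<in> \<rho> \<gamma>" "z \<in> upper_halfplane"
  shows "moebius M z \<noteq> z"
proof -
  have "\<forall>\<gamma>\<in>carrier surface_group. \<gamma> \<noteq> \<one>\<^bsub>surface_group\<^esub> \<longrightarrow>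
      (\<forall>M\<in>\<rho> \<gamma>. \<forall>z\<in>upper_halfplane. moebius M z \<noteq> z)"
    by (rule hyperbolic[unfolded hyperbolic_metric_def, THEN conjunct2, THEN conjunct1])
  with assms show ?thesis by metis
qed

lemma cocompact:
  "\<exists>K. compact K \<and> K \<subseteq> upper_halfplane \<and>
      (\<forall>z\<in>upper_halfplane. \<exists>M\<in>image_lifts. moebius M z \<in> K)"
  by (rule hyperbolic[unfolded hyperbolic_metric_def, THEN conjunct2, THEN conjunct2, THEN conjunct2])

lemma discrete_image_lifts: "discrete image_lifts"
  by (rule hyperbolic[unfolded hyperbolic_metric_def, THEN conjunct2, THEN conjunct2, THEN conjunct1])

text \<open>Includes the trivial element, so it applies to commutators without deciding whether they
  are trivial.\<close>

lemma trace_lift_ge_2: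
  assumes "M \<in> \<rho> \<gamma>" "\<gamma> \<in> carrier surface_group"
  shows "\<bar>trace M\<bar> \<ge> 2"
proof (cases "\<gamma> = \<one>\<^bsub>surface_group\<^esub>")
  case True
  then have "M \<in> {mat 1, - mat 1}" using assms lifts_Nil surface_one by simp
  then show ?thesis by (auto simp: mat_mat2)
next
  case False
  then show ?thesis
    using elliptic_fixed_point[OF lift_cases(1)[OF assms]] fixed_point_free[OF assms(2) _ assms(1)]
    by (meson not_less)
qed

text \<open>Absolute value 2 would, up to sign, give trace 2; by cocompactness such a lift is the
  identity matrix, which fixes \<open>\<i>\<close> and contradicts freeness.\<close>

lemma trace_lift_gt_2:
  assumes "M \<in> \<rho> \<gamma>" "\<gamma> \<in> carrier surface_group" "\<gamma> \<noteq> \<one>\<^bsub>surface_group\<^esub>"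
  shows "\<bar>trace M\<bar> > 2"
proof (rule ccontr)
  assume "\<not> \<bar>trace M\<bar> > 2"
  then have "\<bar>trace M\<bar> = 2" using trace_lift_ge_2[OF assms(1,2)] by simp
  then have "trace M = 2 \<or> trace (- M) = 2" by (simp only: trace_uminus_2) arith
  then obtain N where N: "N \<in> \<rho> \<gamma>" "trace N = 2"
    using assms(1) lift_uminus[OF assms(1,2)] by blast
  obtain K where K: "compact K" "K \<subseteq> upper_halfplane"
      "\<And>z. z \<in> upper_halfplane \<Longrightarrow> \<exists>M\<in>image_lifts. moebius M z \<in> K"
    using cocompact by auto
  have "N = mat 1"
  proof (rule cocompact_no_parabolic[where G = image_lifts and K = K])
    show "discrete image_lifts" by (rule discrete_image_lifts)
    show "mat 1 \<in> image_lifts" by (rule image_liftsI[of _ "surface_class []"]) (simp_all add: lifts_Nil)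
    show "det M = 1" if "M \<in> image_lifts" for M
      using that by (rule image_liftsE) (rule lift_cases)
    show "M ** N \<in> image_lifts" if "M \<in> image_lifts" "N \<in> image_lifts" for M N
      using that(1)
    proof (rule image_liftsE)
      fix \<gamma> assume g: "M \<in> \<rho> \<gamma>" "\<gamma> \<in> carrier surface_group"
      show ?thesis using that(2)
      proof (rule image_liftsE)
        fix \<delta> assume "N \<in> \<rho> \<delta>" "\<delta> \<in> carrier surface_group"
        with g show ?thesis
          using lift_mult monoid.m_closed[OF group.is_monoid[OF group_surface_group]]
          by (intro image_liftsI[of _ "\<gamma> \<otimes>\<^bsub>surface_group\<^esub> \<delta>"])
      qed
    qed
    show "\<exists>N\<in>image_lifts. M ** N = mat 1 \<and> N ** M = mat 1" if M: "M \<in> image_lifts" for M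
    proof -
      interpret S: group surface_group by (rule group_surface_group)
      obtain \<gamma> where g: "\<gamma> \<in> carrier surface_group" "M \<in> \<rho> \<gamma>" using M by (rule image_liftsE)
      then have i: "inv\<^bsub>surface_group\<^esub> \<gamma> \<in> carrier surface_group" by simp
      obtain N where N: "N \<in> \<rho> (inv\<^bsub>surface_group\<^esub> \<gamma>)" using lift_exists[OF i] .
      have "M ** N \<in> lifts []"
        using lift_mult[OF g(2) N g(1) i] g(1) by (simp add: surface_one)
      then have "M ** N = mat 1 \<or> M ** (- N) = mat 1"
        by (cases M; cases N) (auto simp: lifts_Nil mat_mat2)
      moreover have "- N \<in> \<rho> (inv\<^bsub>surface_group\<^esub> \<gamma>)" using lift_uminus[OF N i] .
      ultimately show ?thesis
        using image_liftsI[OF _ i] N by (metis matrix_left_right_inverse)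
    qed
  qed (use K N assms in auto)
  then have "moebius N \<i> = \<i>" by (simp add: mat_mat2 moebius_mat2)
  moreover have "\<i> \<in> upper_halfplane" by (simp add: upper_halfplane_def)
  ultimately show False using fixed_point_free[OF assms(2,3) N(1)] by blast
qed

lemma Tr_lift:
  assumes "M \<in> \<rho> \<gamma>" "\<gamma> \<in> carrier surface_group" "\<gamma> \<noteq> \<one>\<^bsub>surface_group\<^esub>"
  shows "Tr \<rho> \<gamma> = \<bar>trace M\<bar>"
  using Tr_eq_abs_trace lift_cases[OF assms(1,2)] trace_lift_gt_2[OF assms] by blast

lemma Tr_lifts:
  assumes "M \<in> lifts w" "exponent_sum s w \<noteq> 0"
  shows "Tr \<rho> (surface_class w) = \<bar>trace M\<bar>"
  using Tr_lift assms surface_class_nontrivial by simp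

end

section \<open>Trace identities\<close>

definition sl2_inv :: "real^2^2 \<Rightarrow> real^2^2"
  where "sl2_inv M = mat2 (vec_nth (vec_nth M 2) 2) (- vec_nth (vec_nth M 1) 2)
    (- vec_nth (vec_nth M 2) 1) (vec_nth (vec_nth M 1) 1)"

lemma sl2_inv_mat2 [simp]: "sl2_inv (mat2 a b c d) = mat2 d (- b) (- c) a"
  by (simp add: sl2_inv_def)

lemma sl2_inv_left: "det M = 1 \<Longrightarrow> sl2_inv M ** M = mat 1"
  by (cases M) (simp add: mat_mat2 algebra_simps)

lemma sl2_inv_right: "det M = 1 \<Longrightarrow> M ** sl2_inv M = mat 1"
  by (cases M) (simp add: mat_mat2 algebra_simps)

lemma det_sl2_inv [simp]: "det (sl2_inv M) = det M"
  by (cases M) (simp add: mult.commute)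

lemma trace_commutator:
  assumes "det A = 1" "det B = 1"
  shows "trace (sl2_inv B ** sl2_inv A ** B ** A) =
    (trace A)\<^sup>2 + (trace B)\<^sup>2 + (trace (A ** B))\<^sup>2 - trace A * trace B * trace (A ** B) - 2"
proof (cases A, cases B)
  fix a b c d p q r s
  assume M: "A = mat2 a b c d" "B = mat2 p q r s"
  have "a * d - b * c = 1" "p * s - q * r = 1" using assms M by auto
  then show ?thesis unfolding M
    by simp algebra
qed

text \<open>The traces of \<open>A ** B ** C\<close> and \<open>A ** C ** B\<close> are the two
  roots of a monic quadratic whose coefficients are polynomials in the six traces of the single
  matrices and of their pairwise products. This is that quadratic, evaluated at the first
  root.\<close>

lemma fricke_relation:
  fixes A B C :: "real^2^2"
  assumes "det A = 1" "det B = 1" "det C = 1"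
  shows "(trace (A ** B ** C))\<^sup>2
    - trace (A ** B ** C) * (trace A * trace (B ** C) + trace B * trace (A ** C)
        + trace C * trace (A ** B) - trace A * trace B * trace C)
    + (trace A)\<^sup>2 + (trace B)\<^sup>2 + (trace C)\<^sup>2
    + (trace (A ** B))\<^sup>2 + (trace (B ** C))\<^sup>2 + (trace (A ** C))\<^sup>2
    - trace A * trace B * trace (A ** B) - trace B * trace C * trace (B ** C)
    - trace A * trace C * trace (A ** C)
    + trace (A ** B) * trace (B ** C) * trace (A ** C) = 4"
proof (cases A, cases B, cases C)
  fix a1 a2 a3 a4 b1 b2 b3 b4 c1 c2 c3 c4
  assume M: "A = mat2 a1 a2 a3 a4" "B = mat2 b1 b2 b3 b4" "C = mat2 c1 c2 c3 c4"
  have det: "a1 * a4 - a2 * a3 = 1" "b1 * b4 - b2 * b3 = 1" "c1 * c4 - c2 * c3 = 1"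
    using assms M by auto
  let ?x = "a1 + a4" and ?y = "b1 + b4" and ?z = "c1 + c4"
  let ?X = "a1*b1 + a2*b3 + (a3*b2 + a4*b4)" and ?Y = "b1*c1 + b2*c3 + (b3*c2 + b4*c4)"
    and ?Z = "a1*c1 + a2*c3 + (a3*c2 + a4*c4)"
  let ?w = "(a1*b1 + a2*b3)*c1 + (a1*b2 + a2*b4)*c3 + ((a3*b1 + a4*b3)*c2 + (a3*b2 + a4*b4)*c4)"
  let ?p = "a1*a4 - a2*a3" and ?q = "b1*b4 - b2*b3" and ?r = "c1*c4 - c2*c3"
  \<comment> \<open>Weighting the terms with determinants makes every term of the same degree in
    each matrix; the result is a polynomial identity in the entries, true without any condition on
    them.\<close>
  have "?w\<^sup>2 - ?w * (?x * ?Y + ?y * ?Z + ?z * ?X - ?x * ?y * ?z)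
    + ?x\<^sup>2 * (?q * ?r) + ?y\<^sup>2 * (?p * ?r) + ?z\<^sup>2 * (?p * ?q) + ?X\<^sup>2 * ?r + ?Y\<^sup>2 * ?p + ?Z\<^sup>2 * ?q
    - ?x * ?y * ?X * ?r - ?y * ?z * ?Y * ?p - ?x * ?z * ?Z * ?q + ?X * ?Y * ?Z = 4 * (?p * ?q * ?r)"
    by algebra
  then have "?w\<^sup>2 - ?w * (?x * ?Y + ?y * ?Z + ?z * ?X - ?x * ?y * ?z)
    + ?x\<^sup>2 + ?y\<^sup>2 + ?z\<^sup>2 + ?X\<^sup>2 + ?Y\<^sup>2 + ?Z\<^sup>2
    - ?x * ?y * ?X - ?y * ?z * ?Y - ?x * ?z * ?Z + ?X * ?Y * ?Z = 4"
    unfolding det mult_1_right by simp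
  then show ?thesis unfolding M mat2_mult trace_mat2 .
qed

text \<open>The signs \<open>e\<close>, \<open>d\<close>, \<open>d'\<close> are those of the traces of the lifts of \<open>A\<^sub>1B\<^sub>1\<close>, \<open>\<gamma>\<^sub>8\<close> and
  \<open>\<gamma>\<^sub>9\<close> relative to lifts of the generators with positive trace; all but one choice is excluded
  by positivity of a polynomial, written in powers of \<open>x - 2\<close> or \<open>x - 3\<close>.\<close>

lemma surface_trace_polynomial:
  fixes x t e d d' :: real
  assumes "x > 2" "\<bar>e\<bar> = 1" "\<bar>d\<bar> = 1" "\<bar>d'\<bar> = 1" "\<bar>t\<bar> \<ge> 2"
    and t: "t = 3 * x^2 - e * x^3 - 2"
    and eq: "t^2 + 2 * x^4 + x^2 + d * d' * x * (x^2 - 2) * t - 2 * x^2 * t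
      - 2 * d * x^3 - 2 * d' * x^2 * (x^2 - 2) = 0"
  shows "x \<ge> 3 \<and> x^5 - 9 * x^4 + 2 * x^3 + 11 * x^2 - 4 * x - 4 = 0"
proof (cases "e = 1")
  case False
  then have e: "e = - 1" using assms(2) by auto
  define y where "y = x - 2"
  have y: "y > 0" "x = y + 2" using assms(1) by (auto simp: y_def)
  note pos = add_pos_pos mult_pos_pos zero_less_power[OF y(1)] y(1)
  have t: "t = (y + 2)^3 + 3 * (y + 2)^2 - 2" using t by (simp add: e y(2))
  consider "d = 1" "d' = 1" | "d = 1" "d' = - 1" | "d = - 1" "d' = 1" | "d = - 1" "d' = - 1"
    using assms(3,4) by (auto simp: abs_if split: if_splits)
  then have False
  proof cases
    case 1
    have "0 = 256 + 800*y + 977*y^2 + 594*y^3 + 191*y^4 + 31*y^5 + 2*y^6"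
      using eq unfolding 1 t y(2) by algebra
    moreover have "\<dots> > 0" by (intro pos) auto
    ultimately show False by simp
  next
    case 2
    have "0 = 144 + 344*y + 297*y^2 + 114*y^3 + 19*y^4 + y^5"
      using eq unfolding 2 t y(2) by algebra
    moreover have "\<dots> > 0" by (intro pos) auto
    ultimately show False by simp
  next
    case 3
    have "0 = 144 + 296*y + 233*y^2 + 86*y^3 + 15*y^4 + y^5"
      using eq unfolding 3 t y(2) by algebra
    moreover have "\<dots> > 0" by (intro pos) auto
    ultimately show False by simp
  next
    case 4
    have "0 = 320 + 944*y + 1089*y^2 + 630*y^3 + 195*y^4 + 31*y^5 + 2*y^6"
      using eq unfolding 4 t y(2) by algebra
    moreover have "\<dots> > 0" by (intro pos) auto
    ultimately show False by simp
  qed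
  then show ?thesis ..
next
  case True
  \<comment> \<open>\<open>2 - t\<close> factors as \<open>(x - 2)\<^sup>2 * (x + 1)\<close>, so
    \<open>t < 2\<close>. The bound on the absolute value then leaves only
    \<open>t \<le> - 2\<close>, which is what yields \<open>x \<ge> 3\<close>.\<close>
  define z where "z = x - 2"
  have z: "z > 0" "x = z + 2" using assms(1) by (auto simp: z_def)
  have "2 - t = z^2 * (z + 3)" unfolding t True z(2) by algebra
  moreover have "z^2 * (z + 3) > 0" using z by simp
  ultimately have "t \<le> - 2" using assms(5) by linarith
  moreover have "t + 2 = x^2 * (3 - x)" unfolding t True by algebra
  ultimately have "x^2 * (3 - x) \<le> 0" by linarith
  then have "x \<ge> 3" using assms(1) by (simp add: mult_le_0_iff)
  define y where "y = x - 3"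
  have y: "y \<ge> 0" "x = y + 3" using \<open>x \<ge> 3\<close> by (auto simp: y_def)
  note pos = add_pos_nonneg mult_nonneg_nonneg zero_le_power[OF y(1)] y(1)
  have t: "t = 3 * (y + 3)^2 - (y + 3)^3 - 2" using t by (simp add: True y(2))
  consider "d = 1" "d' = 1" | "d = 1" "d' = - 1" | "d = - 1" "d' = 1" | "d = - 1" "d' = - 1"
    using assms(3,4) by (auto simp: abs_if split: if_splits)
  then show ?thesis
  proof cases
    case 1
    have "0 = 11 + 41*y + 57*y^2 + 36*y^3 + 10*y^4 + y^5"
      using eq unfolding 1 t y(2) by algebra
    moreover have "\<dots> > 0" by (intro pos) auto
    ultimately show ?thesis by simp
  next
    case 2
    have "0 = 325 + 821*y + 889*y^2 + 520*y^3 + 170*y^4 + 29*y^5 + 2*y^6"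
      using eq unfolding 2 t y(2) by algebra
    moreover have "\<dots> > 0" by (intro pos) auto
    ultimately show ?thesis by simp
  next
    case 3
    have "0 = 181 + 545*y + 717*y^2 + 476*y^3 + 166*y^4 + 29*y^5 + 2*y^6"
      using eq unfolding 3 t y(2) by algebra
    moreover have "\<dots> > 0" by (intro pos) auto
    ultimately show ?thesis by simp
  next
    case 4
    \<comment> \<open>For these signs the sixth powers of \<open>x\<close> cancel and
      \<open>eq\<close> is minus the quintic.\<close>
    have "x^5 - 9 * x^4 + 2 * x^3 + 11 * x^2 - 4 * x - 4 = 0"
      using eq unfolding 4 t y(2) by algebra
    then show ?thesis using \<open>x \<ge> 3\<close> by simp
  qed
qed

context holonomy
begin

lemma positive_lift:
  assumes "exponent_sum s w \<noteq> 0"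
  obtains M where "M \<in> lifts w" "trace M = Tr \<rho> (surface_class w)" "det M = 1"
proof -
  obtain M where M: "M \<in> lifts w" using lift_exists surface_class_carrier by blast
  have "\<bar>trace M\<bar> = Tr \<rho> (surface_class w)" using Tr_lifts[OF M assms] by simp
  then consider "trace M = Tr \<rho> (surface_class w)" | "trace (- M) = Tr \<rho> (surface_class w)"
    unfolding trace_uminus_2 by linarith
  then show ?thesis
    using that M lift_uminus[OF M surface_class_carrier] lift_cases(1)[OF _ surface_class_carrier]
    by metis
qed

lemma lift_sl2_inv:
  assumes "M \<in> lifts [(s, e)]"
  shows "sl2_inv M \<in> lifts [(s, \<not> e)]"
  using lift_inverse[OF assms sl2_inv_left] lift_cases(1)[OF assms surface_class_carrier] by simp

text \<open>\<open>fricke_relation\<close> is applied to \<open>c\<close>, \<open>D\<close>,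
  \<open>a\<close>, lifts of \<open>A2\<close>, of a conjugate of the inverse of \<open>A1\<close>,
  and of \<open>A1\<close>. Their pairwise products lift \<open>gamma 8\<close>,
  \<open>gamma 9\<close> and a commutator, and by the surface relation the triple product is
  conjugate to \<open>c\<close>. Thus all seven traces are known up to the three signs.\<close>

lemma surface_traces:
  assumes A1: "Tr \<rho> (gamma 1) = x" and B1: "Tr \<rho> (gamma 2) = x" and A1B1: "Tr \<rho> (gamma 3) = x"
    and A2: "Tr \<rho> (gamma 4) = x" and B2: "Tr \<rho> (gamma 5) = x" and A2B2: "Tr \<rho> (gamma 6) = x"
    and g8: "Tr \<rho> (gamma 8) = x" and g9: "Tr \<rho> (gamma 9) = x\<^sup>2 - 2"
  shows "\<exists>M\<in>\<rho> (gamma 1). trace M = x \<and> x \<ge> 3 \<and> x^5 - 9 * x^4 + 2 * x^3 + 11 * x^2 - 4 * x - 4 = 0"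
proof -
  note ex = exponent_sum_def
  obtain a where a: "a \<in> lifts [pos A1]" "trace a = x" "det a = 1"
    using positive_lift[of A1 "[pos A1]"] A1 by (auto simp: ex gamma_def)
  obtain b where b: "b \<in> lifts [pos B1]" "trace b = x" "det b = 1"
    using positive_lift[of B1 "[pos B1]"] B1 by (auto simp: ex gamma_def)
  obtain c where c: "c \<in> lifts [pos A2]" "trace c = x" "det c = 1"
    using positive_lift[of A2 "[pos A2]"] A2 by (auto simp: ex gamma_def)
  obtain d where d: "d \<in> lifts [pos B2]" "trace d = x" "det d = 1"
    using positive_lift[of B2 "[pos B2]"] B2 by (auto simp: ex gamma_def)
  have ne: "surface_class [pos A1] \<noteq> \<one>\<^bsub>surface_group\<^esub>"
    by (rule surface_class_nontrivial[of A1]) (simp add: ex)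
  have "x > 2"
    using trace_lift_gt_2[OF a(1) surface_class_carrier ne] Tr_lift[OF a(1) surface_class_carrier ne] A1 a(2)
    by (simp add: gamma_def)
  note inv = lift_sl2_inv[of _ _ True, simplified]
  define D where "D = sl2_inv b ** sl2_inv a ** b"
  define C1 where "C1 = D ** a"
  define C2 where "C2 = sl2_inv d ** sl2_inv c ** d ** c"
  have "D \<in> lifts (([neg B1] @ [neg A1]) @ [pos B1])"
    unfolding D_def by (intro lifts_append inv a b)
  then have D: "D \<in> lifts [neg B1, neg A1, pos B1]" by simp
  have dD: "det D = 1" "det C1 = 1" "det C2 = 1" using a b c d by (simp_all add: D_def C1_def C2_def det_mul)
  have "C2 \<in> lifts ((([neg B2] @ [neg A2]) @ [pos B2]) @ [pos A2])"
    unfolding C2_def by (intro lifts_append inv c d)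
  then have C2: "C2 \<in> lifts [neg B2, neg A2, pos B2, pos A2]" by simp
  have C1: "C1 \<in> lifts ([neg B1, neg A1, pos B1] @ [pos A1])"
    unfolding C1_def by (intro lifts_append D a)
  have "C2 ** C1 \<in> lifts ([neg B2, neg A2, pos B2, pos A2] @ ([neg B1, neg A1, pos B1] @ [pos A1]))"
    by (intro lifts_append C1 C2)
  moreover have "surface_class ([neg B2, neg A2, pos B2, pos A2] @ ([neg B1, neg A1, pos B1] @ [pos A1]))
      = surface_class []"
    using surface_eq.relator by (simp add: surface_class_eq_iff)
  ultimately have rel: "C2 ** C1 = mat 1 \<or> C2 ** C1 = - mat 1" by (simp add: lifts_Nil)
  have ab: "\<bar>trace (a ** b)\<bar> = x" using Tr_lifts[OF lifts_append[OF a(1) b(1)], of A1] A1B1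
    by (simp add: ex gamma_def)
  have cd: "\<bar>trace (c ** d)\<bar> = x" using Tr_lifts[OF lifts_append[OF c(1) d(1)], of A2] A2B2
    by (simp add: ex gamma_def)
  have cD: "\<bar>trace (c ** D)\<bar> = x" using Tr_lifts[OF lifts_append[OF c(1) D], of A2] g8
    by (simp add: ex gamma_def)
  have ca: "\<bar>trace (c ** a)\<bar> = x\<^sup>2 - 2" using Tr_lifts[OF lifts_append[OF c(1) a(1)], of A2] g9
    by (simp add: ex gamma_def)
  have D_tr: "trace D = x"
  proof -
    have "trace D = trace (b ** (sl2_inv b ** sl2_inv a))" unfolding D_def by (rule trace_mul_sym)
    also have "\<dots> = trace (sl2_inv a)" using b(3) by (simp add: matrix_mul_assoc sl2_inv_right)
    also have "\<dots> = x" using a(2) by (cases a) simp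
    finally show ?thesis .
  qed
  have "x\<^sup>2 > 2" using \<open>x > 2\<close> power_strict_mono[of 2 x 2] by simp
  obtain e where e: "\<bar>e\<bar> = 1" "trace (a ** b) = e * x"
    using ab \<open>x > 2\<close> that[of 1] that[of "- 1"] by (auto simp: abs_if split: if_splits)
  obtain e' where e': "\<bar>e'\<bar> = 1" "trace (c ** d) = e' * x"
    using cd \<open>x > 2\<close> that[of 1] that[of "- 1"] by (auto simp: abs_if split: if_splits)
  obtain f where f: "\<bar>f\<bar> = 1" "trace (c ** D) = f * x"
    using cD \<open>x > 2\<close> that[of 1] that[of "- 1"] by (auto simp: abs_if split: if_splits)
  obtain f' where f': "\<bar>f'\<bar> = 1" "trace (c ** a) = f' * (x\<^sup>2 - 2)"
    using ca \<open>x\<^sup>2 > 2\<close> that[of 1] that[of "- 1"] by (auto simp: abs_if split: if_splits)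
  have sq: "e\<^sup>2 = 1" "e'\<^sup>2 = 1" "f\<^sup>2 = 1" "f'\<^sup>2 = 1"
    using e(1) e'(1) f(1) f'(1) by (simp_all add: power2_eq_1_iff abs_eq_iff')
  have t1: "trace C1 = 3 * x\<^sup>2 - e * x^3 - 2"
    using trace_commutator[OF a(3) b(3)] sq(1) unfolding C1_def D_def a(2) b(2) e(2)
    by (simp add: power_mult_distrib power2_eq_square power3_eq_cube)
  have t2: "trace C2 = 3 * x\<^sup>2 - e' * x^3 - 2"
    using trace_commutator[OF c(3) d(3)] sq(2) unfolding C2_def c(2) d(2) e'(2)
    by (simp add: power_mult_distrib power2_eq_square power3_eq_cube)
  \<comment> \<open>With the other sign the commutator traces would be opposite and nonzero, hence
    \<open>e' = - e\<close>; adding the two commutator formulas then cancels the cubic terms and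
    leaves \<open>6 * x\<^sup>2 = 4\<close>.\<close>
  have rel: "C2 ** C1 = mat 1"
  proof (rule ccontr)
    assume "C2 ** C1 \<noteq> mat 1"
    then have "C2 ** C1 = - mat 1" using rel by blast
    then have "C2 ** C1 ** sl2_inv C1 = - sl2_inv C1" by (cases "sl2_inv C1") (simp add: mat_mat2)
    then have "C2 = - sl2_inv C1"
      using dD(2) by (simp add: matrix_mul_assoc[symmetric] sl2_inv_right)
    then have "trace C2 = - trace C1" by (cases C1) simp
    moreover have "\<bar>trace C1\<bar> \<ge> 2" by (rule trace_lift_ge_2[OF C1 surface_class_carrier])
    ultimately have "trace C1 \<noteq> trace C2" by auto
    then have "e \<noteq> e'" using t1 t2 by auto
    then have "e' = - e" using e(1) e'(1) by auto
    then have "6 * x\<^sup>2 = 4" using t1 t2 \<open>trace C2 = - trace C1\<close> by simp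
    then show False using \<open>x\<^sup>2 > 2\<close> by simp
  qed
  \<comment> \<open>The aim is \<open>c ** C1 = sl2_inv d ** c ** d\<close>, reached by inserting
    the relation and cancelling one letter after the other.\<close>
  have "c ** d = c ** (d ** (C2 ** C1))" unfolding rel by simp
  also have "\<dots> = c ** ((d ** sl2_inv d) ** (sl2_inv c ** (d ** (c ** C1))))"
    by (simp only: C2_def matrix_mul_assoc)
  also have "\<dots> = (c ** sl2_inv c) ** (d ** (c ** C1))"
    unfolding sl2_inv_right[OF d(3)] by (simp only: matrix_mul_assoc matrix_mul_lid)
  finally have "sl2_inv d ** (c ** d) = (sl2_inv d ** d) ** (c ** C1)"
    unfolding sl2_inv_right[OF c(3)] by (simp only: matrix_mul_assoc matrix_mul_lid)
  then have "c ** D ** a = sl2_inv d ** c ** d"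
    unfolding sl2_inv_left[OF d(3)] C1_def by (simp only: matrix_mul_assoc matrix_mul_lid)
  then have "trace (c ** D ** a) = trace (sl2_inv d ** c ** d)" by simp
  also have "\<dots> = trace (d ** (sl2_inv d ** c))" by (rule trace_mul_sym)
  also have "\<dots> = x" using d(3) c(2) by (simp add: matrix_mul_assoc sl2_inv_right)
  finally have w: "trace (c ** D ** a) = x" .
  have eq: "(trace C1)\<^sup>2 + 2 * x^4 + x\<^sup>2 + f * f' * x * (x\<^sup>2 - 2) * trace C1 - 2 * x\<^sup>2 * trace C1
      - 2 * f * x^3 - 2 * f' * x\<^sup>2 * (x\<^sup>2 - 2) = 0"
  proof -
    have s: "(f * x)\<^sup>2 = x\<^sup>2" "(f' * (x\<^sup>2 - 2))\<^sup>2 = (x\<^sup>2 - 2)\<^sup>2"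
      by (simp_all add: power_mult_distrib sq)
    then show ?thesis
      using fricke_relation[OF c(3) dD(1) a(3)]
      unfolding w a(2) c(2) D_tr f(2) f'(2) C1_def[symmetric] s
      by (simp add: algebra_simps power2_eq_square power3_eq_cube power4_eq_xxxx)
  qed
  have "\<bar>trace C1\<bar> \<ge> 2" by (rule trace_lift_ge_2[OF C1 surface_class_carrier])
  from surface_trace_polynomial[OF \<open>x > 2\<close> e(1) f(1) f'(1) this t1 eq]
  show ?thesis using a by (auto simp: gamma_def)
qed

end

section \<open>Embeddings of real number fields\<close>

locale real_subfield =
  fixes F :: "real set"
  assumes one_mem: "1 \<in> F"
    and diff_mem: "x \<in> F \<Longrightarrow> y \<in> F \<Longrightarrow> x - y \<in> F"
    and mult_mem: "x \<in> F \<Longrightarrow> y \<in> F \<Longrightarrow> x * y \<in> F"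
    and inverse_mem: "x \<in> F \<Longrightarrow> inverse x \<in> F"
begin

lemma zero_mem: "0 \<in> F"
  using diff_mem[OF one_mem one_mem] by simp

lemma uminus_mem: "x \<in> F \<Longrightarrow> - x \<in> F"
  using diff_mem[OF zero_mem] by simp

lemma add_mem: "x \<in> F \<Longrightarrow> y \<in> F \<Longrightarrow> x + y \<in> F"
  using diff_mem[OF _ uminus_mem] by fastforce

lemma divide_mem: "x \<in> F \<Longrightarrow> y \<in> F \<Longrightarrow> x / y \<in> F"
  by (simp add: divide_inverse mult_mem inverse_mem)

lemma sum_mem: "(\<And>i. i \<in> A \<Longrightarrow> f i \<in> F) \<Longrightarrow> sum f A \<in> F"
  by (induction A rule: infinite_finite_induct) (auto simp: zero_mem add_mem)

lemma power_mem: "x \<in> F \<Longrightarrow> x ^ n \<in> F"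
  by (induction n) (auto simp: one_mem mult_mem)

lemma of_nat_mem: "of_nat n \<in> F"
  by (induction n) (auto simp: zero_mem one_mem add_mem)

lemma of_int_mem: "of_int n \<in> F"
  by (cases n rule: int_cases2) (auto simp: of_nat_mem uminus_mem)

lemma Rats_subset: "\<rat> \<subseteq> F"
  by (auto elim!: Rats_cases' simp: divide_mem of_int_mem)

section \<open>Polynomials over a subfield and simple algebraic extensions\<close>

definition polys :: "real poly set"
  where "polys = {p. \<forall>i. coeff p i \<in> F}"

lemma polysD: "p \<in> polys \<Longrightarrow> coeff p i \<in> F"
  by (simp add: polys_def)

lemma zero_polys: "0 \<in> polys" by (simp add: polys_def zero_mem)

lemma monom_polys: "c \<in> F \<Longrightarrow> monom c n \<in> polys"
  by (simp add: polys_def zero_mem)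

lemma const_polys: "c \<in> F \<Longrightarrow> [:c:] \<in> polys"
  using monom_polys[of c 0] by (simp add: monom_0)

lemma add_polys: "p \<in> polys \<Longrightarrow> q \<in> polys \<Longrightarrow> p + q \<in> polys"
  by (simp add: polys_def add_mem)

lemma diff_polys: "p \<in> polys \<Longrightarrow> q \<in> polys \<Longrightarrow> p - q \<in> polys"
  by (simp add: polys_def diff_mem)

lemma mult_polys: "p \<in> polys \<Longrightarrow> q \<in> polys \<Longrightarrow> p * q \<in> polys"
  by (simp add: polys_def coeff_mult sum_mem mult_mem)

text \<open>Long division involves only quotients of coefficients, so quotient and remainder stay
  over \<open>F\<close>.\<close>

lemma polys_division:
  assumes "q \<in> polys" "q \<noteq> 0" "p \<in> polys"
  shows "\<exists>s\<in>polys. \<exists>t\<in>polys. p = q * s + t \<and> (t = 0 \<or> degree t < degree q)"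
  using assms(3)
proof (induction "degree p" arbitrary: p rule: less_induct)
  case less
  show ?case
  proof (cases "p = 0 \<or> degree p < degree q")
    case True
    with less zero_polys show ?thesis by (intro bexI[of _ 0] bexI[of _ p]) auto
  next
    case False
    define m where "m = monom (lead_coeff p / lead_coeff q) (degree p - degree q)"
    have m: "m \<in> polys" unfolding m_def
      by (intro monom_polys divide_mem polysD less.prems assms)
    have "degree (q * m) \<le> degree p"
      using degree_mult_le[of q m] degree_monom_le[of "lead_coeff p / lead_coeff q" "degree p - degree q"] False
      unfolding m_def by linarith
    then have "degree (p - q * m) \<le> degree p" by (intro degree_diff_le) auto
    moreover have "coeff (q * m) (degree p) = lead_coeff p"
      using False assms(2) by (simp add: m_def mult.commute[of q] coeff_monom_mult)
    then have "coeff (p - q * m) (degree p) = 0" by simp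
    ultimately have "p - q * m = 0 \<or> degree (p - q * m) < degree p"
      using eq_zero_or_degree_less by blast
    then show ?thesis
    proof
      assume "p - q * m = 0"
      with m zero_polys show ?thesis by (intro bexI[of _ m] bexI[of _ 0]) auto
    next
      assume "degree (p - q * m) < degree p"
      from less.hyps[OF this] m less.prems assms(1) obtain s t where
        st: "s \<in> polys" "t \<in> polys" "p - q * m = q * s + t" "t = 0 \<or> degree t < degree q"
        by (auto simp: diff_polys mult_polys)
      then have "p = q * (m + s) + t" by (simp add: algebra_simps)
      with st m show ?thesis by (intro bexI[of _ "m + s"] bexI[of _ t]) (auto simp: add_polys)
    qed
  qed
qed

definition algebraic_over :: "real \<Rightarrow> bool"
  where "algebraic_over a \<longleftrightarrow> (\<exists>p\<in>polys. p \<noteq> 0 \<and> poly p a = 0)"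

text \<open>Not normalised to be monic: least degree is all that division with remainder
  uses.\<close>

definition minimal_poly :: "real \<Rightarrow> real poly \<Rightarrow> bool"
  where "minimal_poly a p \<longleftrightarrow> p \<in> polys \<and> p \<noteq> 0 \<and> poly p a = 0 \<and>
    (\<forall>q\<in>polys. q \<noteq> 0 \<longrightarrow> poly q a = 0 \<longrightarrow> degree p \<le> degree q)"

lemma minimal_poly_exists:
  assumes "algebraic_over a"
  obtains p where "minimal_poly a p"
proof -
  let ?P = "\<lambda>p. p \<in> polys \<and> p \<noteq> 0 \<and> poly p a = 0"
  obtain q where "?P q" using assms by (auto simp: algebraic_over_def)
  then have "minimal_poly a (arg_min degree ?P)"
    unfolding minimal_poly_def using arg_min_natI[of ?P q degree] arg_min_nat_le[of ?P _ degree] by blast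
  then show ?thesis by (rule that)
qed

lemma minimal_poly_dvd:
  assumes "minimal_poly a p" "q \<in> polys" "poly q a = 0"
  obtains s where "s \<in> polys" "q = p * s"
proof -
  obtain s t where st: "s \<in> polys" "t \<in> polys" "q = p * s + t" "t = 0 \<or> degree t < degree p"
    using polys_division[of p q] assms by (auto simp: minimal_poly_def)
  then have "poly t a = 0" using assms by (auto simp: minimal_poly_def)
  then have "t = 0" using st assms(1) unfolding minimal_poly_def by (meson not_less)
  then show ?thesis using st that by simp
qed

lemma minimal_poly_degree_pos:
  assumes "minimal_poly a p"
  shows "degree p > 0"
proof (rule ccontr)
  assume "\<not> degree p > 0"
  then obtain c where "p = [:c:]" by (auto elim: degree_eq_zeroE)
  then show False using assms by (simp add: minimal_poly_def)
qed

text \<open>Descent on the degree of \<open>q\<close>. Dividing \<open>p\<close> by \<open>q\<close>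
  gives \<open>q(a) s(a) = - t(a)\<close> with \<open>t\<close> of smaller degree, so an inverse of
  \<open>t(a)\<close> yields one of \<open>q(a)\<close>. If \<open>t(a) = 0\<close>, minimality
  forces \<open>t = 0\<close> and then \<open>q\<close> constant.\<close>

lemma adjoin_inverse:
  assumes "minimal_poly a p" "q \<in> polys" "poly q a \<noteq> 0"
  shows "\<exists>r\<in>polys. poly q a * poly r a = 1"
proof -
  have *: "\<exists>r\<in>polys. poly q a * poly r a = 1"
    if "q \<in> polys" "poly q a \<noteq> 0" "degree q < degree p" for q
    using that
  proof (induction "degree q" arbitrary: q rule: less_induct)
    case less
    then have "q \<noteq> 0" by auto
    then obtain s t where st: "s \<in> polys" "t \<in> polys" "p = q * s + t" "t = 0 \<or> degree t < degree q"
      using polys_division[of q p] assms less.prems by (auto simp: minimal_poly_def)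
    have pa: "poly q a * poly s a + poly t a = 0"
      using st(3) assms(1) by (auto simp: minimal_poly_def)
    show ?case
    proof (cases "poly t a = 0")
      case True
      then have t: "t = 0"
        using st less.prems assms(1) unfolding minimal_poly_def by (metis less_trans not_less)
      have "p \<noteq> 0" using assms by (simp add: minimal_poly_def)
      then have "s \<noteq> 0" "degree p = degree q + degree s"
        using st(3) t \<open>q \<noteq> 0\<close> by (auto simp: degree_mult_eq)
      moreover have "poly s a = 0" using pa True less.prems by simp
      ultimately have "degree p \<le> degree s" using st(1) assms(1) unfolding minimal_poly_def by blast
      then have "degree q = 0" using \<open>degree p = degree q + degree s\<close> by simp
      then obtain c where c: "q = [:c:]" by (auto elim: degree_eq_zeroE)
      then have "c \<in> F" using polysD[OF less.prems(1), of 0] by simp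
      then show ?thesis using c less.prems
        by (intro bexI[of _ "[:inverse c:]"]) (auto intro: const_polys inverse_mem)
    next
      case False
      then have "t \<noteq> 0" by auto
      then have "degree t < degree q" using st by blast
      from less.hyps[OF this st(2) False] this less.prems obtain r where
        r: "r \<in> polys" "poly t a * poly r a = 1" by auto
      have "poly q a * poly (0 - s * r) a = 1"
      proof -
        have "poly t a = - (poly q a * poly s a)" using pa by linarith
        then show ?thesis using r(2) by simp
      qed
      then show ?thesis using r st by (intro bexI[of _ "0 - s * r"] diff_polys mult_polys zero_polys)
    qed
  qed
  have p: "p \<in> polys" "p \<noteq> 0" "poly p a = 0" using assms(1) by (auto simp: minimal_poly_def)
  obtain s t where st: "s \<in> polys" "t \<in> polys" "q = p * s + t" "t = 0 \<or> degree t < degree p"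
    using polys_division[OF p(1,2) assms(2)] by blast
  then have eq: "poly t a = poly q a" using p by simp
  then have "t \<noteq> 0" using assms(3) by auto
  then have "degree t < degree p" using st(4) by blast
  then show ?thesis using *[OF st(2)] assms(3) unfolding eq by blast
qed

lemma adjoin_real_subfield:
  assumes "algebraic_over a"
  shows "real_subfield ((\<lambda>q. poly q a) ` polys)"
proof -
  obtain p where p: "minimal_poly a p" using minimal_poly_exists[OF assms] .
  show ?thesis
  proof
    show "1 \<in> (\<lambda>q. poly q a) ` polys"
      by (rule image_eqI[of _ _ "[:1:]"]) (auto intro: const_polys one_mem)
  next
    fix x y assume "x \<in> (\<lambda>q. poly q a) ` polys" "y \<in> (\<lambda>q. poly q a) ` polys"
    then obtain q r where "q \<in> polys" "r \<in> polys" "x = poly q a" "y = poly r a" by blast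
    then show "x - y \<in> (\<lambda>q. poly q a) ` polys" "x * y \<in> (\<lambda>q. poly q a) ` polys"
      by (auto intro: image_eqI[of _ _ "q - r"] diff_polys image_eqI[of _ _ "q * r"] mult_polys)
  next
    fix x assume "x \<in> (\<lambda>q. poly q a) ` polys"
    then obtain q where q: "q \<in> polys" "x = poly q a" by blast
    show "inverse x \<in> (\<lambda>q. poly q a) ` polys"
    proof (cases "x = 0")
      case True
      then show ?thesis using q by auto
    next
      case False
      then obtain r where "r \<in> polys" "x * poly r a = 1"
        using adjoin_inverse[OF p] q by blast
      then show ?thesis by (auto intro!: image_eqI[of _ _ r] inverse_unique)
    qed
  qed
qed

end

lemma real_subfield_Rats: "real_subfield \<rat>"
  by unfold_locales auto

section \<open>Extension of embeddings\<close>

locale real_subfield_embedding = real_subfield F for F +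
  fixes \<sigma> :: "real \<Rightarrow> 'a::field_char_0"
  assumes embedding: "field_embedding F \<sigma>"
begin

lemma map_one: "\<sigma> 1 = 1"
  using embedding by (simp add: field_embedding_def)

lemma map_add: "x \<in> F \<Longrightarrow> y \<in> F \<Longrightarrow> \<sigma> (x + y) = \<sigma> x + \<sigma> y"
  using embedding by (simp add: field_embedding_def)

lemma map_mult: "x \<in> F \<Longrightarrow> y \<in> F \<Longrightarrow> \<sigma> (x * y) = \<sigma> x * \<sigma> y"
  using embedding by (simp add: field_embedding_def)

lemma map_zero: "\<sigma> 0 = 0"
  using map_add[OF zero_mem zero_mem] by simp

lemma map_uminus: "x \<in> F \<Longrightarrow> \<sigma> (- x) = - \<sigma> x"
  using map_add[OF _ uminus_mem, of x x] by (simp add: map_zero eq_neg_iff_add_eq_0 add.commute)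

lemma map_diff: "x \<in> F \<Longrightarrow> y \<in> F \<Longrightarrow> \<sigma> (x - y) = \<sigma> x - \<sigma> y"
  using map_add[of x "- y"] by (simp add: map_uminus uminus_mem)

lemma map_sum: "(\<And>i. i \<in> A \<Longrightarrow> f i \<in> F) \<Longrightarrow> \<sigma> (sum f A) = (\<Sum>i\<in>A. \<sigma> (f i))"
  by (induction A rule: infinite_finite_induct) (auto simp: map_zero map_add sum_mem)

lemma map_eq_0: "x \<in> F \<Longrightarrow> \<sigma> x = 0 \<Longrightarrow> x = 0"
  using map_mult[of x "inverse x"] map_one inverse_mem[of x] by (cases "x = 0") auto

lemma coeff_map [simp]: "coeff (map_poly \<sigma> p) n = \<sigma> (coeff p n)"
  by (simp add: coeff_map_poly map_zero)

lemma map_poly_add: "p \<in> polys \<Longrightarrow> q \<in> polys \<Longrightarrow> map_poly \<sigma> (p + q) = map_poly \<sigma> p + map_poly \<sigma> q"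
  by (simp add: poly_eq_iff map_add polysD)

lemma map_poly_mult: "p \<in> polys \<Longrightarrow> q \<in> polys \<Longrightarrow> map_poly \<sigma> (p * q) = map_poly \<sigma> p * map_poly \<sigma> q"
  by (simp add: poly_eq_iff coeff_mult map_sum map_mult polysD mult_mem)

lemma degree_map: "p \<in> polys \<Longrightarrow> degree (map_poly \<sigma> p) = degree p"
  by (cases "p = 0") (auto intro!: map_poly_degree_eq dest: map_eq_0[OF polysD])

text \<open>Send \<open>poly q a\<close> to the value at \<open>z\<close> of \<open>q\<close> with
  \<open>\<sigma>\<close> applied to its coefficients. Two representatives \<open>q\<close> of the
  same number differ by a multiple of \<open>p\<close>, whose image vanishes at \<open>z\<close>, so
  the choice made by \<open>inv_into\<close> does not matter.\<close>

lemma extend_embedding: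
  assumes "minimal_poly a p" "poly (map_poly \<sigma> p) z = 0"
  obtains F' \<sigma>' where "real_subfield_embedding F' \<sigma>'" "F \<subseteq> F'" "a \<in> F'"
    "\<And>x. x \<in> F \<Longrightarrow> \<sigma>' x = \<sigma> x" "\<sigma>' a = z"
proof
  have alg: "algebraic_over a" using assms(1) by (auto simp: minimal_poly_def algebraic_over_def)
  define F' where "F' = (\<lambda>q. poly q a) ` polys"
  define rep where "rep = inv_into polys (\<lambda>q. poly q a)"
  define \<sigma>' where "\<sigma>' = (\<lambda>y. poly (map_poly \<sigma> (rep y)) z)"
  have eq: "poly (map_poly \<sigma> q) z = poly (map_poly \<sigma> r) z"
    if qr: "q \<in> polys" "r \<in> polys" "poly q a = poly r a" for q r
  proof -
    have "poly (q - r) a = 0" using qr by simp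
    then obtain s where s: "s \<in> polys" "q - r = p * s"
      using minimal_poly_dvd[OF assms(1) diff_polys[OF qr(1,2)]] by blast
    have p: "p \<in> polys" using assms(1) by (simp add: minimal_poly_def)
    have "q = p * s + r" using s(2) by (simp add: algebra_simps)
    then have "map_poly \<sigma> q = map_poly \<sigma> p * map_poly \<sigma> s + map_poly \<sigma> r"
      using s(1) p qr by (simp add: map_poly_add map_poly_mult mult_polys)
    then show ?thesis using assms(2) by simp
  qed
  have rep: "rep (poly q a) \<in> polys" "poly (rep (poly q a)) a = poly q a" if "q \<in> polys" for q
    using that by (auto simp: rep_def intro!: inv_into_into f_inv_into_f)
  have \<sigma>': "\<sigma>' (poly q a) = poly (map_poly \<sigma> q) z" if "q \<in> polys" for q
    unfolding \<sigma>'_def by (rule eq) (use that rep in auto)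
  have const: "\<sigma>' x = \<sigma> x" if "x \<in> F" for x
    using \<sigma>'[OF const_polys[OF that]] by (simp add: map_poly_pCons map_zero)
  have X: "[:0, 1:] \<in> polys" using monom_polys[OF one_mem, of 1] by (simp add: monom_altdef)
  show "real_subfield_embedding F' \<sigma>'"
  proof (intro real_subfield_embedding.intro real_subfield_embedding_axioms.intro)
    show "real_subfield F'" unfolding F'_def by (rule adjoin_real_subfield[OF alg])
    have "\<sigma>' 1 = 1" using const[OF one_mem] map_one by simp
    moreover have "\<sigma>' (x + y) = \<sigma>' x + \<sigma>' y \<and> \<sigma>' (x * y) = \<sigma>' x * \<sigma>' y" if xy: "x \<in> F'" "y \<in> F'" for x y
    proof -
      obtain q r where qr: "q \<in> polys" "r \<in> polys" "x = poly q a" "y = poly r a"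
        using xy by (auto simp: F'_def)
      then show ?thesis
        using \<sigma>'[OF add_polys[OF qr(1,2)]] \<sigma>'[OF mult_polys[OF qr(1,2)]] \<sigma>'[OF qr(1)] \<sigma>'[OF qr(2)]
        by (simp add: map_poly_add map_poly_mult)
    qed
    ultimately show "field_embedding F' \<sigma>'" by (simp add: field_embedding_def)
  qed
  show "F \<subseteq> F'" unfolding F'_def
  proof
    fix x assume "x \<in> F"
    then show "x \<in> (\<lambda>q. poly q a) ` polys" by (intro image_eqI[of _ _ "[:x:]"] const_polys) auto
  qed
  show "a \<in> F'" unfolding F'_def by (intro image_eqI[of _ _ "[:0, 1:]"] X) auto
  show "\<sigma>' x = \<sigma> x" if "x \<in> F" for x by (rule const[OF that])
  show "\<sigma>' a = z" using \<sigma>'[OF X] by (simp add: map_poly_pCons map_zero map_one)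
qed

end

text \<open>Each \<open>s\<close> gets its minimal polynomial over the field reached so far, not
  over the rationals, so that its image is compatible with the values already fixed; the complex
  numbers supply a root.\<close>

lemma real_subfield_embedding_extend_finite:
  fixes \<sigma> :: "real \<Rightarrow> complex"
  assumes "finite S" "real_subfield_embedding F \<sigma>" "\<And>s. s \<in> S \<Longrightarrow> real_subfield.algebraic_over \<rat> s"
  shows "\<exists>F' \<sigma>'. real_subfield_embedding F' \<sigma>' \<and> F \<subseteq> F' \<and> S \<subseteq> F' \<and> (\<forall>x\<in>F. \<sigma>' x = \<sigma> x)"
  using assms(1,3)
proof (induction S rule: finite_induct)
  case empty
  show ?case using assms(2) by blast
next
  case (insert s S)
  then obtain F1 \<sigma>1 where 1: "real_subfield_embedding F1 \<sigma>1" "F \<subseteq> F1" "S \<subseteq> F1" "\<forall>x\<in>F. \<sigma>1 x = \<sigma> x"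
    by auto
  interpret real_subfield_embedding F1 \<sigma>1 by (rule 1)
  interpret Q: real_subfield \<rat> by (rule real_subfield_Rats)
  have "algebraic_over s"
    using insert.prems[of s] Rats_subset unfolding Q.algebraic_over_def algebraic_over_def Q.polys_def polys_def
    by blast
  then obtain p where p: "minimal_poly s p" by (rule minimal_poly_exists)
  then have "degree (map_poly \<sigma>1 p) > 0"
    using degree_map minimal_poly_degree_pos[OF p] by (simp add: minimal_poly_def)
  then obtain z where "poly (map_poly \<sigma>1 p) z = 0" using alg_closed_imp_poly_has_root by blast
  from extend_embedding[OF p this] obtain F2 \<sigma>2 where
    "real_subfield_embedding F2 \<sigma>2" "F1 \<subseteq> F2" "s \<in> F2" "\<And>x. x \<in> F1 \<Longrightarrow> \<sigma>2 x = \<sigma>1 x" by metis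
  then show ?case using 1 by (intro exI[of _ F2] exI[of _ \<sigma>2]) auto
qed

lemma real_number_field_real_subfield: "real_number_field k \<Longrightarrow> real_subfield k"
  by (auto simp: real_number_field_def intro: real_subfield.intro)

text \<open>The \<open>card S + 1\<close> powers of \<open>x\<close> lie in a rational span of
  \<open>card S\<close> elements, so they are linearly dependent.\<close>

lemma real_number_field_algebraic:
  assumes "real_number_field k" "x \<in> k"
  shows "real_subfield.algebraic_over \<rat> x"
proof -
  interpret k: real_subfield k by (rule real_number_field_real_subfield[OF assms(1)])
  interpret Q: real_subfield \<rat> by (rule real_subfield_Rats)
  interpret V: vector_space "\<lambda>(q::rat) (x::real). of_rat q * x"
    by unfold_locales (auto simp: algebra_simps of_rat_add of_rat_mult)
  obtain S where S: "finite S" "\<And>x. x \<in> k \<Longrightarrow> \<exists>q :: real \<Rightarrow> rat. x = (\<Sum>s\<in>S. of_rat (q s) * s)"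
    using assms(1) unfolding real_number_field_def by blast
  have span: "y \<in> V.span S" if "y \<in> k" for y
  proof -
    obtain q :: "real \<Rightarrow> rat" where q: "y = (\<Sum>s\<in>S. of_rat (q s) * s)" using S(2)[OF \<open>y \<in> k\<close>] by blast
    show ?thesis unfolding q by (intro V.span_sum V.span_scale V.span_base)
  qed
  show ?thesis
  \<comment> \<open>Dependence is a property of sets, so coinciding powers are treated apart; they
    give a polynomial at once.\<close>
  proof (cases "inj_on (\<lambda>i. x ^ i) {..card S}")
    case False
    then obtain i j where ij: "i \<noteq> j" "x ^ i = x ^ j" by (auto simp: inj_on_def)
    have "coeff (monom 1 i - monom 1 j :: real poly) i = 1" using ij(1) by simp
    then have "monom 1 i - monom 1 j \<noteq> (0 :: real poly)" by (metis coeff_0 zero_neq_one)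
    moreover have "poly (monom 1 i - monom 1 j) x = 0" using ij by (simp add: poly_monom)
    ultimately show ?thesis unfolding Q.algebraic_over_def
      by (intro bexI[of _ "monom 1 i - monom 1 j"] Q.diff_polys Q.monom_polys) auto
  next
    case True
    let ?T = "(\<lambda>i. x ^ i) ` {..card S}"
    have "V.dependent ?T"
    proof (rule ccontr)
      assume "\<not> V.dependent ?T"
      moreover have "?T \<subseteq> V.span S" using span k.power_mem[OF assms(2)] by blast
      ultimately have "card ?T \<le> card S" using V.independent_span_bound[OF S(1)] by blast
      then show False using card_image[OF True] by simp
    qed
    then obtain u :: "real \<Rightarrow> rat" where
      u: "\<exists>v\<in>?T. u v \<noteq> 0" "(\<Sum>v\<in>?T. of_rat (u v) * v) = 0"
      using V.dependent_finite[of ?T] by auto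
    obtain i where i: "i \<le> card S" "u (x ^ i) \<noteq> 0" using u(1) by auto
    define p :: "real poly" where "p = (\<Sum>i\<le>card S. monom (of_rat (u (x ^ i))) i)"
    have c: "coeff p j = (if j \<le> card S then of_rat (u (x ^ j)) else 0)" for j
      by (simp add: p_def coeff_sum)
    have "p \<in> Q.polys" by (simp add: Q.polys_def c)
    moreover have "coeff p i \<noteq> 0" using i by (simp add: c)
    then have "p \<noteq> 0" by auto
    moreover have "poly p x = 0"
      using u(2) by (simp add: p_def poly_sum poly_monom sum.reindex[OF True])
    ultimately show ?thesis unfolding Q.algebraic_over_def by blast
  qed
qed

text \<open>The number \<open>a\<close> is adjoined first, because its image is prescribed; the
  generators of \<open>k\<close> follow with whatever images are available.\<close>

lemma real_number_field_embedding_exists: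
  fixes z :: complex
  assumes k: "real_number_field k"
    and p: "real_subfield.minimal_poly \<rat> a p" "poly (map_poly of_real p) z = 0"
  obtains F \<sigma> where "real_subfield_embedding F \<sigma>" "k \<subseteq> F" "a \<in> F" "\<sigma> a = z"
proof -
  interpret Q: real_subfield \<rat> by (rule real_subfield_Rats)
  interpret Q: real_subfield_embedding \<rat> "of_real :: real \<Rightarrow> complex"
    by unfold_locales (simp add: field_embedding_def)
  obtain F0 \<sigma>0 where 0: "real_subfield_embedding F0 \<sigma>0" "a \<in> F0" "\<sigma>0 a = z"
    using Q.extend_embedding[OF p] by metis
  obtain S where S: "finite S" "S \<subseteq> k" "\<And>x. x \<in> k \<Longrightarrow> \<exists>q :: real \<Rightarrow> rat. x = (\<Sum>s\<in>S. of_rat (q s) * s)"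
    using k unfolding real_number_field_def by blast
  obtain F \<sigma> where F: "real_subfield_embedding F \<sigma>" "F0 \<subseteq> F" "S \<subseteq> F" "\<forall>x\<in>F0. \<sigma> x = \<sigma>0 x"
    using real_subfield_embedding_extend_finite[OF S(1) 0(1)] real_number_field_algebraic[OF k] S(2) by blast
  interpret F: real_subfield_embedding F \<sigma> by (rule F(1))
  have "k \<subseteq> F"
  proof
    fix y assume "y \<in> k"
    then obtain q :: "real \<Rightarrow> rat" where q: "y = (\<Sum>s\<in>S. of_rat (q s) * s)" using S(3) by blast
    show "y \<in> F" unfolding q using F(3) F.Rats_subset by (intro F.sum_mem F.mult_mem) auto
  qed
  then show ?thesis using that[OF F(1)] F 0 by auto
qed

section \<open>Irreducibility of the quintic\<close>

abbreviation quintic :: "'a::comm_ring_1 poly"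
  where "quintic \<equiv> [:- 4, - 4, 11, 2, - 9, 1:]"

lemma quintic_no_int_linear_factor:
  fixes r :: int
  shows "poly quintic r \<noteq> 0"
proof
  assume "poly quintic r = 0"
  then have *: "r * (r * (r * (r * (r - 9) + 2) + 11) - 4) = 4" by (simp add: algebra_simps)
  then have "r dvd 4" by (metis dvd_triv_left)
  then have "\<bar>r\<bar> \<le> 4" using dvd_imp_le_int[of 4 r] by simp
  then have "r = -4 \<or> r = -3 \<or> r = -2 \<or> r = -1 \<or> r = 0 \<or> r = 1 \<or> r = 2 \<or> r = 3 \<or> r = 4" by arith
  then show False using * by (elim disjE) simp_all
qed

text \<open>The hypotheses make the quadratic positive at 1 and at -10 and monotone outward from
  there, so only the integers from -9 to 0 have to be tested.\<close>

lemma int_quadratic_no_root: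
  fixes a p q r :: int
  assumes "p > 0" "q > 0" "p + q + r > 0" "100 * p - 10 * q + r > 0" "20 * p > q"
    "\<forall>k\<in>{-9, -8, -7, -6, -5, -4, -3, -2, -1, 0}. p * k^2 + q * k + r \<noteq> 0"
  shows "p * a^2 + q * a + r \<noteq> 0"
proof -
  have "a \<ge> 1 \<or> a \<le> - 10 \<or> a \<in> {-9, -8, -7, -6, -5, -4, -3, -2, -1, 0}"
    unfolding insert_iff empty_iff by presburger
  then consider "a \<ge> 1" | "a \<le> - 10" | "a \<in> {-9, -8, -7, -6, -5, -4, -3, -2, -1, 0}"
    by blast
  then show ?thesis
  proof cases
    case 1
    then have "p * 1 \<le> p * a^2" "q * 1 \<le> q * a" using assms by (intro mult_left_mono; simp)+
    then show ?thesis using assms by linarith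
  next
    case 2
    define k where "k = - 10 - a"
    have k: "k \<ge> 0" "a = - 10 - k" using 2 by (auto simp: k_def)
    have "p * a^2 + q * a + r = p * k^2 + (20 * p - q) * k + (100 * p - 10 * q + r)"
      unfolding k(2) by (simp add: power2_eq_square algebra_simps)
    moreover have "p * k^2 \<ge> 0" "(20 * p - q) * k \<ge> 0" using k(1) assms by auto
    ultimately show ?thesis using assms by linarith
  next
    case 3
    then show ?thesis using assms by blast
  qed
qed

text \<open>Comparing coefficients eliminates \<open>c\<close> and \<open>d\<close>. As
  \<open>b * e = - 4\<close>, six pairs remain, each leaving a quadratic for \<open>a\<close>
  without integer roots.\<close>

lemma quintic_no_int_quadratic_factor:
  fixes a b c d e :: int
  shows "[:b, a, 1:] * [:e, d, c, 1:] \<noteq> quintic"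
proof
  assume "[:b, a, 1:] * [:e, d, c, 1:] = quintic"
  then have eqs: "b * e = - 4" "b * d + a * e = - 4" "b + a * c + d = 2" "a + c = - 9"
    by (simp_all add: ac_simps)
  have c: "c = - 9 - a" using eqs(4) by simp
  have d: "d = 2 - b + a * (9 + a)" using eqs(3) unfolding c by (simp add: algebra_simps)
  have *: "b * a^2 + (9 * b + e) * a + (2 * b - b^2 + 4) = 0"
    using eqs(2) unfolding d by (simp add: algebra_simps power2_eq_square)
  have "b dvd 4" using eqs(1) by (metis dvd_minus_iff dvd_triv_left)
  then have "\<bar>b\<bar> \<le> 4" using dvd_imp_le_int[of 4 b] by simp
  then have "b = -4 \<or> b = -3 \<or> b = -2 \<or> b = -1 \<or> b = 0 \<or> b = 1 \<or> b = 2 \<or> b = 3 \<or> b = 4" by arith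
  then consider "b = -4" "e = 1" | "b = -2" "e = 2" | "b = -1" "e = 4"
    | "b = 1" "e = -4" | "b = 2" "e = -2" | "b = 4" "e = -1"
    using eqs(1) by (elim disjE) (simp_all, presburger+)
  then show False
  proof cases
    case 1
    \<comment> \<open>In each case the quadratic is \<open>*\<close>, divided by a common factor and
      made positive in its leading coefficient.\<close>
    then show False using * int_quadratic_no_root[of 4 35 20 a] by simp
  next
    case 2
    then show False using * int_quadratic_no_root[of 1 8 2 a] by simp
  next
    case 3
    then show False using * int_quadratic_no_root[of 1 5 "- 1" a] by simp
  next
    case 4
    then show False using * int_quadratic_no_root[of 1 5 5 a] by simp
  next
    case 5
    then show False using * int_quadratic_no_root[of 1 8 2 a] by simp
  next
    case 6
    then show False using * int_quadratic_no_root[of 4 35 "- 4" a] by simp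
  qed
qed

lemma quintic_int_factor_aux:
  fixes f g :: "int poly"
  assumes "f * g = quintic" "degree f > 0" "degree f \<le> 2"
  shows False
proof -
  have nz: "f \<noteq> 0" "g \<noteq> 0" using assms by auto
  have deg: "degree f + degree g = 5"
    using degree_mult_eq[OF nz] assms(1) by simp
  have "lead_coeff f * lead_coeff g = 1" using lead_coeff_mult[of f g] assms(1) by simp
  then have "lead_coeff f = 1 \<and> lead_coeff g = 1 \<or> lead_coeff f = - 1 \<and> lead_coeff g = - 1"
    by (rule zmult_eq_1_iff[THEN iffD1])
  \<comment> \<open>Negating both factors if necessary makes both monic.\<close>
  then obtain f' g' :: "int poly" where fg: "f' * g' = quintic" "lead_coeff f' = 1" "lead_coeff g' = 1"
      "degree f' = degree f" "degree g' = degree g"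
    using assms(1) that[of f g] that[of "- f" "- g"] by auto
  have c: "coeff f' (degree f) = 1" "coeff g' (degree g) = 1" using fg by auto
  have expand: "p = [:coeff p 0, coeff p 1, coeff p 2, coeff p 3:]" if "degree p \<le> 3" for p :: "int poly"
  proof (rule poly_eqI)
    fix n show "coeff p n = coeff [:coeff p 0, coeff p 1, coeff p 2, coeff p 3:] n"
      using that coeff_eq_0[of p n]
      by (auto simp: coeff_pCons numeral_2_eq_2 numeral_3_eq_3 split: nat.splits)
  qed
  consider "degree f = 1" | "degree f = 2" using assms by linarith
  then show False
  proof cases
    case 1
    have "f' = [:coeff f' 0, coeff f' 1, coeff f' 2, coeff f' 3:]" using fg 1 by (intro expand) simp
    also have "\<dots> = [:coeff f' 0, 1:]"
      using c 1 fg(4) coeff_eq_0[of f' 2] coeff_eq_0[of f' 3] by simp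
    finally obtain r where "f' = [:r, 1:]" by blast
    then have "poly f' (- r) = 0" by simp
    then have "poly (f' * g') (- r) = 0" by simp
    then show False unfolding fg(1) using quintic_no_int_linear_factor by blast
  next
    case 2
    have "f' = [:coeff f' 0, coeff f' 1, coeff f' 2, coeff f' 3:]" using fg 2 by (intro expand) simp
    also have "\<dots> = [:coeff f' 0, coeff f' 1, 1:]"
      using c 2 fg(4) coeff_eq_0[of f' 3] by simp
    finally have f: "f' = [:coeff f' 0, coeff f' 1, 1:]" .
    have dg: "degree g = 3" using deg 2 by simp
    have "g' = [:coeff g' 0, coeff g' 1, coeff g' 2, coeff g' 3:]" using fg dg by (intro expand) simp
    also have "\<dots> = [:coeff g' 0, coeff g' 1, coeff g' 2, 1:]"
      using c(2) dg by simp
    finally have "[:coeff f' 0, coeff f' 1, 1:] * [:coeff g' 0, coeff g' 1, coeff g' 2, 1:] = quintic"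
      using f fg(1) by metis
    then show False using quintic_no_int_quadratic_factor by blast
  qed
qed

lemma quintic_int_factor:
  fixes f g :: "int poly"
  assumes "f * g = quintic" "degree f > 0"
  shows "degree f \<ge> 5"
proof (rule ccontr)
  assume "\<not> degree f \<ge> 5"
  have nz: "f \<noteq> 0" "g \<noteq> 0" using assms by auto
  have deg: "degree f + degree g = 5"
    using degree_mult_eq[OF nz] assms(1) by simp
  show False
  proof (cases "degree f \<le> 2")
    case True
    then show ?thesis using quintic_int_factor_aux assms by blast
  next
    case False
    then have "degree g > 0" "degree g \<le> 2" using deg \<open>\<not> degree f \<ge> 5\<close> by auto
    then show ?thesis using quintic_int_factor_aux[of g f] assms(1) by (simp add: mult.commute)
  qed
qed

lemma rat_poly_clear_denominators:
  fixes p :: "real poly"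
  assumes "\<And>i. coeff p i \<in> \<rat>"
  shows "\<exists>d (f :: int poly). d \<noteq> 0 \<and> map_poly of_int f = smult (of_int d) p"
  using assms
proof (induction p)
  case 0
  show ?case by (intro exI[of _ 1] exI[of _ 0]) simp
next
  case (pCons a p)
  have "coeff p i \<in> \<rat>" for i using pCons.prems[of "Suc i"] by simp
  then obtain d and f :: "int poly" where df: "d \<noteq> 0" "map_poly of_int f = smult (of_int d) p"
    using pCons.IH by blast
  have "a \<in> \<rat>" using pCons.prems[of 0] by simp
  then obtain m n where mn: "n > 0" "a = of_int m / of_int n" by (auto elim: Rats_cases')
  have "map_poly of_int (pCons (d * m) (smult n f)) = smult (of_int (n * d)) (pCons a p)"
    using mn df(2) by (simp add: map_poly_pCons map_poly_smult)
  then show ?case using df(1) mn(1) by (intro exI[of _ "n * d"] exI[of _ "pCons (d * m) (smult n f)"]) auto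
qed

lemma map_poly_of_int_mult:
  "map_poly of_int (p * q) = (map_poly of_int p * map_poly of_int q :: 'a::comm_ring_1 poly)"
  by (rule poly_eqI) (simp add: coeff_map_poly coeff_mult)

text \<open>Gauss's lemma: after clearing denominators contents multiply, and the primitive parts
  factor \<open>h\<close>. The sign remains because contents are nonnegative while
  \<open>d * e\<close> may be negative.\<close>

lemma rat_factor_int_factor:
  fixes p q :: "real poly" and h :: "int poly"
  assumes "\<And>i. coeff p i \<in> \<rat>" "\<And>i. coeff q i \<in> \<rat>" "p * q = map_poly of_int h" "content h = 1"
  obtains f g where "f * g = h \<or> f * g = - h" "degree f = degree p"
proof -
  obtain d f where f: "d \<noteq> 0" "map_poly of_int f = smult (of_int d) p"
    using rat_poly_clear_denominators[OF assms(1)] by blast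
  obtain e g where g: "e \<noteq> 0" "map_poly of_int g = smult (of_int e) q"
    using rat_poly_clear_denominators[OF assms(2)] by blast
  have "map_poly of_int (f * g) = (map_poly of_int (smult (d * e) h) :: real poly)"
    unfolding map_poly_of_int_mult f g by (simp add: map_poly_smult assms(3)[symmetric] mult_ac)
  then have fg: "f * g = smult (d * e) h"
    by (simp add: poly_eq_iff coeff_map_poly del: of_int_mult)
  have "smult (content f * content g) (primitive_part f * primitive_part g) = f * g"
    by (metis content_times_primitive_part mult_smult_left mult_smult_right smult_smult)
  moreover have "content f * content g = \<bar>d * e\<bar>"
    using arg_cong[OF fg, of content] assms(4) by (simp add: content_mult normalize_mult abs_mult)
  ultimately have "smult \<bar>d * e\<bar> (primitive_part f * primitive_part g) = smult (d * e) h"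
    using fg by simp
  moreover have "u = h \<or> u = - h" if "smult \<bar>n\<bar> u = smult n h" "n \<noteq> 0" for n and u :: "int poly"
  proof -
    have eq: "\<bar>n\<bar> * coeff u i = n * coeff h i" for i
      using arg_cong[OF that(1), of "\<lambda>p. coeff p i"] by simp
    show ?thesis
    proof (cases "n > 0")
      case True
      with eq have "coeff u i = coeff h i" for i by (metis abs_of_pos mult_cancel_left that(2))
      then show ?thesis by (auto simp: poly_eq_iff)
    next
      case False
      with that(2) have "\<bar>n\<bar> = - n" by simp
      have "coeff u i = - coeff h i" for i
      proof -
        have "n * coeff u i = n * - coeff h i" using eq[of i] unfolding \<open>\<bar>n\<bar> = - n\<close> by simp
        then show ?thesis using that(2) by (simp only: mult_cancel_left) simp
      qed
      then show ?thesis by (auto simp: poly_eq_iff)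
    qed
  qed
  ultimately have "primitive_part f * primitive_part g = h \<or> primitive_part f * primitive_part g = - h"
    using f(1) g(1) by simp
  moreover have "degree (map_poly real_of_int f) = degree f" by (rule degree_map_poly) auto
  then have "degree (primitive_part f) = degree p" using f by simp
  ultimately show ?thesis by (rule that)
qed

text \<open>A minimal polynomial divides the quintic over the rationals, so it yields an integer
  factor of the same positive degree, which must be at least 5.\<close>

lemma quintic_minimal_poly:
  assumes "poly quintic x = 0"
  shows "real_subfield.minimal_poly \<rat> x quintic"
proof -
  interpret Q: real_subfield \<rat> by (rule real_subfield_Rats)
  have P: "quintic \<in> Q.polys" by (auto simp: Q.polys_def coeff_pCons split: nat.splits)
  have nz: "quintic \<noteq> (0 :: real poly)" by simp
  obtain p where p: "Q.minimal_poly x p"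
    by (rule Q.minimal_poly_exists[of x]) (use assms P nz in \<open>auto simp only: Q.algebraic_over_def\<close>)
  obtain s where s: "s \<in> Q.polys" "quintic = p * s" using Q.minimal_poly_dvd[OF p P assms] .
  have "content (quintic :: int poly) dvd coeff quintic 5" by (rule content_dvd_coeff)
  then have "\<bar>content (quintic :: int poly)\<bar> = 1" by (simp add: coeff_pCons eval_nat_numeral)
  then have cont: "content (quintic :: int poly) = 1"
    using normalize_content[of "quintic :: int poly"] by (simp del: normalize_content)
  have "p \<in> Q.polys" using p by (simp add: Q.minimal_poly_def)
  moreover have "p * s = map_poly of_int quintic" using s(2) by (simp add: map_poly_pCons)
  ultimately obtain f g :: "int poly" where fg: "f * g = quintic \<or> f * g = - quintic" "degree f = degree p"
    using rat_factor_int_factor[of p s quintic] s(1) cont by (auto simp: Q.polys_def)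
  have "f * g = quintic \<or> f * - g = quintic" using fg(1) by auto
  then have "degree p \<ge> 5"
    using quintic_int_factor fg(2) Q.minimal_poly_degree_pos[OF p] by metis
  then show ?thesis
    using p P nz assms unfolding Q.minimal_poly_def by (auto intro: order_trans)
qed

section \<open>Roots of the quintic\<close>

text \<open>Serves to show that a root of modulus below 3 and real part not negative cannot be
  real.\<close>

lemma quintic_neg:
  fixes y :: real
  assumes "0 \<le> y" "y \<le> 3"
  shows "poly quintic y < 0"
proof -
  have "poly quintic y = y^4 * (y - 3) - ((y - 1)^2 * (6 * y^2 + 10 * y + 3) + 1)"
    by (simp add: algebra_simps power2_eq_square power4_eq_xxxx)
  moreover have "y^4 * (y - 3) \<le> 0" using assms by (simp add: mult_nonneg_nonpos)
  moreover have "(y - 1)^2 * (6 * y^2 + 10 * y + 3) \<ge> 0" using assms by simp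
  ultimately show ?thesis by linarith
qed

lemma quintic_root_bounds:
  fixes x :: real
  assumes "x \<ge> 3" "poly quintic x = 0"
  shows "8 < x" "x < 9"
proof -
  have P: "poly quintic x = x^4 * (x - 9) + 2 * x^3 + 11 * x^2 - 4 * x - 4"
    by (simp add: algebra_simps power2_eq_square power3_eq_cube power4_eq_xxxx)
  show "x < 9"
  proof (rule ccontr)
    assume "\<not> x < 9"
    then have "x \<ge> 9" by simp
    define y where "y = x - 9"
    have y: "y \<ge> 0" "x = y + 9" using \<open>x \<ge> 9\<close> by (auto simp: y_def)
    have "2 * x^3 + 11 * x^2 - 4 * x - 4 = 2 * y^3 + 65 * y^2 + 680 * y + 2309"
      unfolding y(2) by algebra
    moreover have "\<dots> > 0" using y(1) by (intro add_nonneg_pos add_nonneg_nonneg) auto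
    moreover have "x^4 * (x - 9) \<ge> 0" using y by simp
    ultimately show False using P assms(2) by linarith
  qed
  show "8 < x"
  proof (rule ccontr)
    assume "\<not> 8 < x"
    \<comment> \<open>On each range part of the term \<open>x^4 * (x - 9)\<close> is kept
      nonpositive and the rest absorbs the cubic and quadratic terms: \<open>x - 5\<close> is split
      off on the left, \<open>x - 8\<close> on the right.\<close>
    consider "x \<le> 5" | "x \<ge> 5" by linarith
    then have "x^4 * (x - 9) + 2 * x^3 + 11 * x^2 \<le> 0"
    proof cases
      case 1
      have "x^4 * (x - 9) + 2 * x^3 + 11 * x^2 = x^4 * (x - 5) - x^2 * (4 * x^2 - 2 * x - 11)"
        by algebra
      moreover have "x^4 * (x - 5) \<le> 0" using 1 by (simp add: mult_nonneg_nonpos)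
      moreover have eq: "4 * x^2 - 2 * x - 11 = 4 * (x - 3)^2 + 22 * (x - 3) + 19" by algebra
      have "4 * x^2 - 2 * x - 11 \<ge> 0"
        unfolding eq using assms(1) by (intro add_nonneg_nonneg) auto
      then have "x^2 * (4 * x^2 - 2 * x - 11) \<ge> 0" by simp
      ultimately show ?thesis by linarith
    next
      case 2
      have "x^4 * (x - 9) + 2 * x^3 + 11 * x^2 = x^4 * (x - 8) - x^2 * (x^2 - 2 * x - 11)"
        by algebra
      moreover have "x^4 * (x - 8) \<le> 0" using \<open>\<not> 8 < x\<close> by (simp add: mult_nonneg_nonpos)
      moreover have eq: "x^2 - 2 * x - 11 = (x - 5)^2 + 8 * (x - 5) + 4" by algebra
      have "x^2 - 2 * x - 11 \<ge> 0"
        unfolding eq using 2 by (intro add_nonneg_nonneg) auto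
      then have "x^2 * (x^2 - 2 * x - 11) \<ge> 0" by simp
      ultimately show ?thesis by linarith
    qed
    then show False using P assms by linarith
  qed
qed

text \<open>Every factor has nonnegative real coefficients. Contrapositive use: a negative
  coefficient reveals a root that is nonreal or positive.\<close>

lemma prod_nonpos_roots_coeff:
  fixes A :: "complex multiset"
  assumes "\<And>a. a \<in># A \<Longrightarrow> a \<in> \<real> \<and> Re a \<le> 0"
  shows "coeff (\<Prod>a\<in>#A. [:- a, 1:]) i \<in> \<real> \<and> Re (coeff (\<Prod>a\<in>#A. [:- a, 1:]) i) \<ge> 0"
  using assms
proof (induction A arbitrary: i)
  case empty
  show ?case by (cases i) auto
next
  case (add a A)
  define p where "p = (\<Prod>a\<in>#A. [:- a, 1:])"
  have IH: "coeff p i \<in> \<real>" "Re (coeff p i) \<ge> 0" for i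
    using add unfolding p_def by auto
  obtain r where a: "a = of_real r" "r \<le> 0" using add.prems[of a] by (auto elim: Reals_cases)
  define u where "u = - a * coeff p i"
  have u: "u \<in> \<real>" "Re u \<ge> 0" unfolding u_def using IH[of i] a by (auto simp: mult_nonpos_nonneg)
  have eq: "coeff ([:- a, 1:] * p) i = u + (case i of 0 \<Rightarrow> 0 | Suc j \<Rightarrow> coeff p j)"
    by (simp add: u_def coeff_pCons split: nat.splits)
  have "coeff ([:- a, 1:] * p) i \<in> \<real> \<and> Re (coeff ([:- a, 1:] * p) i) \<ge> 0"
    unfolding eq using IH u by (cases i) auto
  then show ?case by (simp add: p_def)
qed

text \<open>Divide by \<open>X - x\<close>. The quartic quotient \<open>R\<close> has a negative
  cubic coefficient, so some root is nonreal or positive; all its roots have modulus below 3, where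
  \<open>quintic_neg\<close> excludes nonnegative real ones.\<close>

lemma quintic_nonreal_root:
  fixes x :: real
  assumes "8 < x" "x < 9" "poly quintic x = 0"
  shows "\<exists>z::complex. poly quintic z = 0 \<and> z \<notin> \<real> \<and> cmod z < 3"
proof -
  \<comment> \<open>Horner's scheme: these are the coefficients of the quotient.\<close>
  define r3 where "r3 = x - 9"
  define r2 where "r2 = x * r3 + 2"
  define r1 where "r1 = x * r2 + 11"
  define r0 where "r0 = x * r1 - 4"
  have r0x: "x * r0 = 4" using assms(3) unfolding r0_def r1_def r2_def r3_def by (simp add: algebra_simps)
  have b3: "- 1 < r3" "r3 < 0" using assms by (auto simp: r3_def)
  \<comment> \<open>The scheme is now run backwards from the constant term: dividing by
    \<open>x > 8\<close> keeps the bounds tight, whereas multiplying by \<open>x\<close> would spoil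
    them.\<close>
  have r0: "r0 = 4 / x" using r0x assms(1) by (simp add: field_simps)
  have b0: "0 < r0" "r0 < 1" using assms(1) unfolding r0 by (auto simp: field_simps)
  have r1: "r1 = (4 + r0) / x" using assms(1) by (simp add: r0_def field_simps)
  have b1: "0 < r1" "r1 < 1" using assms(1) b0 unfolding r1 by (auto simp: field_simps)
  have r2: "r2 = (r1 - 11) / x" using assms(1) by (simp add: r1_def field_simps)
  have b2: "- 2 < r2" "r2 < 0" using assms(1) b1 unfolding r2 by (auto simp: field_simps)
  define R :: "complex poly" where "R = [:of_real r0, of_real r1, of_real r2, of_real r3, 1:]"
  have "quintic = [:- x * r0, r0 - x * r1, r1 - x * r2, r2 - x * r3, r3 - x, 1:]"
    using r0x by (simp add: r3_def r2_def r1_def r0_def)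
  then have "map_poly complex_of_real quintic
      = map_poly of_real [:- x * r0, r0 - x * r1, r1 - x * r2, r2 - x * r3, r3 - x, 1:]"
    by (rule arg_cong)
  then have PR: "quintic = [:- of_real x, 1:] * R"
    by (simp add: R_def map_poly_pCons mult.commute)
  have bound: "cmod z < 3" if z: "poly R z = 0" for z
  proof (rule ccontr)
    assume "\<not> cmod z < 3"
    define m where "m = cmod z"
    have m: "m \<ge> 3" using \<open>\<not> cmod z < 3\<close> by (simp add: m_def)
    have "z^4 = - (of_real r3 * z^3 + of_real r2 * z^2 + of_real r1 * z + of_real r0)"
      using z by (simp add: R_def algebra_simps power2_eq_square power3_eq_cube power4_eq_xxxx eq_neg_iff_add_eq_0)
    then have "m^4 = cmod (of_real r3 * z^3 + of_real r2 * z^2 + of_real r1 * z + of_real r0)"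
      unfolding m_def by (metis norm_minus_cancel norm_power)
    also have "\<dots> \<le> cmod (of_real r3 * z^3) + cmod (of_real r2 * z^2) + cmod (of_real r1 * z) + cmod (of_real r0)"
      by (intro norm_triangle_le add_mono order_refl)
    also have "\<dots> = \<bar>r3\<bar> * m^3 + \<bar>r2\<bar> * m^2 + \<bar>r1\<bar> * m + \<bar>r0\<bar>"
      by (simp add: m_def norm_mult norm_power)
    also have "\<dots> \<le> 1 * m^3 + 2 * m^2 + 1 * m + 1"
      using b0 b1 b2 b3 m by (intro add_mono mult_right_mono) auto
    finally have "m^4 \<le> m^3 + 2 * m^2 + m + 1" by simp
    moreover define y where "y = m - 3"
    have y: "y \<ge> 0" "m = y + 3" using m by (auto simp: y_def)
    have "m^4 - (m^3 + 2 * m^2 + m + 1) = y^4 + 11 * y^3 + 43 * y^2 + 68 * y + 32"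
      unfolding y(2) by algebra
    moreover have "\<dots> > 0" using y(1) by (intro add_nonneg_pos add_nonneg_nonneg) auto
    ultimately show False by linarith
  qed
  have "R \<noteq> 0" "lead_coeff R = 1" by (auto simp: R_def)
  then obtain A where A: "R = (\<Prod>a\<in>#A. [:- a, 1:])"
    using alg_closed_imp_factorization[of R] by auto
  have "Re (coeff R 3) = r3" by (simp add: R_def numeral_3_eq_3)
  then have "\<not> Re (coeff R 3) \<ge> 0" using b3 by simp
  then obtain z where z: "z \<in># A" "\<not> (z \<in> \<real> \<and> Re z \<le> 0)"
    using prod_nonpos_roots_coeff[of A 3] A by metis
  have "[:- z, 1:] dvd R" unfolding A by (intro dvd_prod_mset) (use z in auto)
  then have root: "poly R z = 0" by (simp add: poly_eq_0_iff_dvd)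
  then have P: "poly quintic z = 0" unfolding PR by simp
  have "z \<notin> \<real>"
  proof
    assume "z \<in> \<real>"
    then obtain y where y: "z = of_real y" by (auto elim: Reals_cases)
    have "of_real (poly quintic y) = poly quintic z" by (simp add: y)
    then have "poly quintic y = 0" unfolding P by (simp only: of_real_eq_0_iff)
    moreover have "0 \<le> y" "y \<le> 3" using z(2) y bound[OF root] \<open>z \<in> \<real>\<close> by auto
    ultimately show False using quintic_neg[of y] by simp
  qed
  with P bound[OF root] show ?thesis by blast
qed

text \<open>The Chebyshev polynomials of the first kind, rescaled to \<open>2 T_n (t / 2)\<close>.
  The integer coefficients make them commute with embeddings.\<close>

fun trace_power :: "nat \<Rightarrow> 'a::comm_ring_1 \<Rightarrow> 'a" where
  "trace_power 0 t = 2"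
| "trace_power (Suc 0) t = t"
| "trace_power (Suc (Suc n)) t = t * trace_power (Suc n) t - trace_power n t"

lemma trace_power_sum_inverse:
  fixes l :: "'a::field"
  assumes "l \<noteq> 0"
  shows "trace_power n (l + 1 / l) = l ^ n + 1 / l ^ n"
  using assms
  by (induction n "l + 1 / l" rule: trace_power.induct) (auto simp: field_simps)

lemma complex_sum_inverse_cases:
  obtains l :: complex where "l \<noteq> 0" "z = l + 1 / l"
proof -
  obtain l where l: "poly [:1, - z, 1:] l = 0"
    using alg_closed_imp_poly_has_root[of "[:1, - z, 1:]"] by auto
  then have "l \<noteq> 0" by auto
  moreover from this l have "z = l + 1 / l" by (simp add: field_simps)
  ultimately show ?thesis by (rule that)
qed

text \<open>Write \<open>z = l + 1 / l\<close> and \<open>m = l ^ n\<close>. Then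
  \<open>m + 1 / m\<close> is real in [-2, 2], so \<open>m\<close> and with it \<open>l\<close> lie
  on the unit circle, and \<open>z = 2 * Re l\<close>.\<close>

lemma trace_power_bounded_real:
  fixes z :: complex
  assumes "n > 0" "trace_power n z = of_real r" "\<bar>r\<bar> \<le> 2"
  shows "z \<in> \<real>"
proof -
  obtain l where l: "l \<noteq> 0" "z = l + 1 / l" by (rule complex_sum_inverse_cases)
  define m where "m = l ^ n"
  have "m \<noteq> 0" using l by (simp add: m_def)
  have "m + 1 / m = of_real r" using assms(2) l by (simp add: trace_power_sum_inverse m_def)
  then have "m * m - of_real r * m + 1 = 0" using \<open>m \<noteq> 0\<close> by (simp add: field_simps)
  then have "Re (m * m - of_real r * m + 1) = 0" "Im (m * m - of_real r * m + 1) = 0" by simp_all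
  then have re: "Re m * Re m - Im m * Im m - r * Re m + 1 = 0" and im: "Im m * (2 * Re m - r) = 0"
    by (simp_all add: algebra_simps)
  have "(Re m)\<^sup>2 + (Im m)\<^sup>2 = 1"
  proof (cases "Im m = 0")
    case True
    have r2: "r\<^sup>2 \<le> 4" using power_mono[OF assms(3), of 2] by simp
    have "(2 * Re m - r)\<^sup>2 = r\<^sup>2 - 4" using re True by (simp add: power2_eq_square algebra_simps)
    then have "(2 * Re m - r)\<^sup>2 \<le> 0" using r2 by simp
    then have "2 * Re m = r" by simp
    with \<open>(2 * Re m - r)\<^sup>2 = r\<^sup>2 - 4\<close> have "(2 * Re m)\<^sup>2 = 4" by simp
    then show ?thesis using True by (simp add: power_mult_distrib)
  next
    case False
    then have "r = 2 * Re m" using im by simp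
    then show ?thesis using re by (simp add: power2_eq_square algebra_simps)
  qed
  then have "cmod m = 1" by (simp add: cmod_def)
  then have "cmod l ^ n = 1" by (simp add: m_def norm_power)
  then have "cmod l = 1" using assms(1) power_eq_imp_eq_base[of "cmod l" n 1] by simp
  then have "1 / l = cnj l" using l(1) by (simp add: divide_conv_cnj)
  then have "z = of_real (2 * Re l)" using l(2) by (simp add: complex_add_cnj)
  then show ?thesis by simp
qed

text \<open>Equality would give \<open>l ^ n\<close> equal to \<open>k ^ n\<close> or to its
  inverse, for \<open>z = l + 1 / l\<close> and \<open>x = k + 1 / k\<close>. So
  \<open>cmod l\<close> is \<open>k\<close> or \<open>1 / k\<close>, and the reverse triangle
  inequality makes \<open>cmod z\<close> at least \<open>k - 1 / k\<close>.\<close>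

lemma trace_power_neq:
  fixes z :: complex
  assumes "n > 0" "8 < x" "cmod z < 3"
  shows "trace_power n z \<noteq> of_real (trace_power n x)"
proof
  assume eq: "trace_power n z = of_real (trace_power n x)"
  obtain l where l: "l \<noteq> 0" "z = l + 1 / l" by (rule complex_sum_inverse_cases)
  obtain k where k: "k > 1" "x = k + 1 / k" using add_inverse_gt_2_cases[of x] assms(2) by auto
  have "1 / k < 1" using k by simp
  then have "k > 7" using k(2) assms(2) by linarith
  define m :: complex where "m = l ^ n"
  define v :: complex where "v = of_real (k ^ n)"
  have nz: "m \<noteq> 0" "v \<noteq> 0" using l k by (auto simp: m_def v_def)
  have "m + 1 / m = v + 1 / v"
    using eq l k by (simp add: trace_power_sum_inverse m_def v_def)
  then have "(m - v) * (m * v - 1) = 0" using nz by (simp add: field_simps)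
  then have "m = v \<or> m * v = 1" by simp
  then have "cmod m = cmod v \<or> cmod m * cmod v = 1" by (metis norm_mult norm_one)
  then have "cmod l ^ n = k ^ n \<or> (cmod l * k) ^ n = 1"
    using k by (simp add: m_def v_def norm_power power_mult_distrib)
  then have "cmod l = k \<or> cmod l * k = 1"
  proof
    assume "cmod l ^ n = k ^ n"
    then show ?thesis using assms(1) k power_eq_imp_eq_base[of "cmod l" n k] by simp
  next
    assume "(cmod l * k) ^ n = 1"
    then show ?thesis using assms(1) k power_eq_imp_eq_base[of "cmod l * k" n 1] by simp
  qed
  then have "\<bar>cmod l - 1 / cmod l\<bar> = k - 1 / k"
  proof
    assume "cmod l = k"
    then show ?thesis using k(1) \<open>1 / k < 1\<close> by (metis abs_of_pos diff_gt_0_iff_gt less_trans)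
  next
    assume "cmod l * k = 1"
    then have "cmod l = 1 / k" using k(1) by (simp add: field_simps)
    then show ?thesis using k(1) \<open>1 / k < 1\<close>
      by (metis abs_minus_commute abs_of_pos diff_gt_0_iff_gt div_by_1 divide_divide_eq_right less_trans mult_1)
  qed
  moreover have "\<bar>cmod l - cmod (- (1 / l))\<bar> \<le> cmod (l - (- (1 / l)))" by (rule norm_triangle_ineq3)
  then have "\<bar>cmod l - 1 / cmod l\<bar> \<le> cmod z" by (simp add: l(2) norm_divide)
  ultimately show False using assms(3) \<open>k > 7\<close> \<open>1 / k < 1\<close> by linarith
qed

section \<open>Arithmeticity\<close>

lemma (in real_subfield_embedding) map_trace_power:
  assumes "x \<in> F"
  shows "trace_power n x \<in> F \<and> \<sigma> (trace_power n x) = trace_power n (\<sigma> x)"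
proof -
  have two: "2 \<in> F" "\<sigma> 2 = 2" using add_mem[OF one_mem one_mem] map_add[OF one_mem one_mem] map_one by simp_all
  show ?thesis using assms
    by (induction n x rule: trace_power.induct)
      (simp_all add: two mult_mem diff_mem map_diff map_mult)
qed

lemma cayley_hamilton_2:
  fixes M :: "real^2^2"
  assumes "det M = 1"
  shows "M ** M = trace M *\<^sub>R M - mat 1"
proof (cases M)
  case (1 a b c d)
  have "a * d - b * c = 1" using assms 1 by simp
  then show ?thesis
    by (simp add: 1 vec_eq_iff forall_2 mat_mat2 algebra_simps)
qed

definition matrix_power :: "real^2^2 \<Rightarrow> nat \<Rightarrow> real^2^2"
  where "matrix_power M n = ((**) M ^^ n) (mat 1)"

lemma matrix_power_simps: "matrix_power M 0 = mat 1" "matrix_power M (Suc n) = M ** matrix_power M n"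
  by (simp_all add: matrix_power_def)

lemma trace_matrix_power:
  assumes "det M = 1"
  shows "trace (matrix_power M n) = trace_power n (trace M)"
proof -
  have step: "trace (M ** (M ** N)) = trace M * trace (M ** N) - trace N" for N
  proof (cases M, cases N)
    fix a b c d p q r s
    assume M: "M = mat2 a b c d" "N = mat2 p q r s"
    have "a * d - b * c = 1" using assms M by simp
    then show ?thesis unfolding M by simp algebra
  qed
  have "trace (matrix_power M n) = trace_power n (trace M) \<and>
      trace (matrix_power M (Suc n)) = trace_power (Suc n) (trace M)"
  proof (induction n)
    case 0
    show ?case by (cases M) (simp add: matrix_power_simps mat_mat2)
  next
    case (Suc n)
    then show ?case using step[of "matrix_power M n"] by (simp add: matrix_power_simps)
  qed
  then show ?thesis ..
qed

section \<open>Quaternions against matrices\<close>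

lemma quat_mult_one_left: "quat_mult a b quat_one x = x"
  by (cases x) simp

lemma quat_mult_one_right: "quat_mult a b x quat_one = x"
  by (cases x) simp

lemma quat_square:
  assumes "reduced_norm a b x = 1"
  shows "quat_mult a b x x = (2 * fst x) *\<^sub>R x - quat_one"
proof (cases x)
  case (fields x0 x1 x2 x3)
  have "x0\<^sup>2 - a * x1\<^sup>2 - b * x2\<^sup>2 + a * b * x3\<^sup>2 = 1" using assms fields by simp
  then show ?thesis by (simp add: fields power2_eq_square algebra_simps)
qed

lemma matrix_iso_one:
  assumes "matrix_iso a b \<Phi>"
  shows "\<Phi> quat_one = mat 1"
proof -
  obtain y where y: "\<Phi> y = mat 1" using assms unfolding matrix_iso_def by (metis bij_pointE)
  have "\<Phi> quat_one = \<Phi> quat_one ** \<Phi> y" unfolding y by simp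
  also have "\<dots> = \<Phi> (quat_mult a b quat_one y)" using assms unfolding matrix_iso_def by metis
  also have "\<dots> = mat 1" unfolding quat_mult_one_left y ..
  finally show ?thesis .
qed

text \<open>The quaternion and its matrix satisfy quadratic equations of the same shape; comparing
  them gives the trace without knowing that the isomorphism carries reduced norm to
  determinant.\<close>

lemma matrix_iso_trace:
  assumes "matrix_iso a b \<Phi>" "reduced_norm a b x = 1" "det (\<Phi> x) = 1"
  shows "trace (\<Phi> x) = 2 * fst x"
proof -
  have lin: "linear \<Phi>" using assms(1) by (simp add: matrix_iso_def)
  have "\<Phi> x ** \<Phi> x = \<Phi> ((2 * fst x) *\<^sub>R x - quat_one)"
    using assms(1) quat_square[OF assms(2)] unfolding matrix_iso_def by metis
  also have "\<dots> = (2 * fst x) *\<^sub>R \<Phi> x - mat 1"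
    using matrix_iso_one[OF assms(1)] by (simp only: linear_diff[OF lin] linear_scale[OF lin])
  finally have "(2 * fst x) *\<^sub>R \<Phi> x = trace (\<Phi> x) *\<^sub>R \<Phi> x"
    unfolding cayley_hamilton_2[OF assms(3)] by (metis diff_add_cancel)
  moreover have "\<Phi> x \<noteq> 0"
  proof
    assume "\<Phi> x = 0"
    then have "det (\<Phi> x) = 0" by (simp add: det_2)
    then show False using assms(3) by simp
  qed
  ultimately show ?thesis by simp
qed

text \<open>In Hamilton's quaternions only real scalars have a nonnegative real square, while the
  basis elements with squares \<open>a\<close> and \<open>b\<close> are not scalars.\<close>

lemma hamilton_iso_negative:
  assumes "hamilton_iso a b \<Psi>"
  shows "a < 0" "b < 0"
proof -
  have lin: "linear \<Psi>" and bij: "bij \<Psi>"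
    and hom: "\<And>x y. \<Psi> (quat_mult a b x y) = quat_mult (- 1) (- 1) (\<Psi> x) (\<Psi> y)"
    using assms by (auto simp: hamilton_iso_def)
  have one: "\<Psi> quat_one = quat_one"
  proof -
    obtain y where y: "\<Psi> y = quat_one" using bij by (metis bij_pointE)
    show ?thesis using hom[of quat_one y] unfolding y quat_mult_one_left quat_mult_one_right by simp
  qed
  have *: "c < 0" if sq: "quat_mult a b u u = c *\<^sub>R quat_one" and indep: "\<And>r. u \<noteq> r *\<^sub>R quat_one" for c u
  proof (rule ccontr)
    assume "\<not> c < 0"
    obtain u0 u1 u2 u3 where u: "\<Psi> u = (u0, u1, u2, u3)" by (metis surj_pair)
    have "quat_mult (- 1) (- 1) (\<Psi> u) (\<Psi> u) = c *\<^sub>R quat_one"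
      using hom[of u u] unfolding sq linear_scale[OF lin] one by simp
    then have eqs: "u0 * u0 - u1 * u1 - u2 * u2 - u3 * u3 = c" "u0 * u1 = 0" "u0 * u2 = 0" "u0 * u3 = 0"
      unfolding u by (auto simp: algebra_simps)
    have "u1 = 0 \<and> u2 = 0 \<and> u3 = 0"
    proof (cases "u0 = 0")
      case True
      then have "u1\<^sup>2 + (u2\<^sup>2 + u3\<^sup>2) \<le> 0" using eqs(1) \<open>\<not> c < 0\<close> by (simp add: power2_eq_square)
      then show ?thesis by (smt (verit) zero_le_power2 power2_eq_iff_nonneg power_zero_numeral zero_eq_power2)
    next
      case False
      then show ?thesis using eqs by simp
    qed
    then have "\<Psi> u = u0 *\<^sub>R quat_one" using u by simp
    also have "\<dots> = \<Psi> (u0 *\<^sub>R quat_one)" unfolding linear_scale[OF lin] one ..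
    finally have "u = u0 *\<^sub>R quat_one" using bij by (meson bij_is_inj inj_eq)
    then show False using indep by blast
  qed
  show "a < 0" by (rule *[of "(0, 1, 0, 0)"]) auto
  show "b < 0" by (rule *[of "(0, 0, 1, 0)"]) auto
qed

text \<open>Pigeonhole: the powers of \<open>g\<close> fall into finitely many cosets of
  \<open>H \<inter> K\<close>, and two powers in the same coset differ by an element of
  \<open>K\<close>.\<close>

lemma commensurable_power_mem:
  fixes G (structure)
  assumes "group G" "\<And>i :: nat. g [^] i \<in> H" "g \<in> carrier G" "H \<subseteq> carrier G" "commensurable G H K" "\<one> \<in> K"
  shows "\<exists>n. (0::nat) < n \<and> g [^] n \<in> K"
proof -
  interpret group G by fact
  let ?c = "\<lambda>i :: nat. (H \<inter> K) #>\<^bsub>G\<lparr>carrier := H\<rparr>\<^esub> (g [^] i)"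
  have "range ?c \<subseteq> rcosets\<^bsub>G\<lparr>carrier := H\<rparr>\<^esub> (H \<inter> K)"
    using assms(2) by (auto simp: RCOSETS_def)
  then have "finite (range ?c)" using assms(5) finite_subset unfolding commensurable_def by blast
  then have "\<not> inj ?c" using finite_imageD infinite_UNIV_nat by blast
  then obtain i j where ij: "i < j" "?c i = ?c j"
    unfolding inj_def by (metis nat_neq_iff)
  have "\<one> \<in> H" using assms(2)[of 0] by simp
  then have "g [^] j \<in> ?c j" using assms(3,6) by (auto simp: r_coset_def intro!: bexI[of _ \<one>])
  then obtain k where k: "k \<in> H \<inter> K" "g [^] j = k \<otimes> g [^] i"
    unfolding ij(2)[symmetric] by (auto simp: r_coset_def)
  have "g [^] (j - i) \<otimes> g [^] i = k \<otimes> g [^] i"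
    using ij(1) assms(3) k(2) by (simp add: nat_pow_mult)
  then have "g [^] (j - i) = k" using assms(3,4) k(1) by (metis IntD1 nat_pow_closed right_cancel subsetD)
  then show ?thesis using ij(1) k(1) by (intro exI[of _ "j - i"]) auto
qed

context holonomy
begin

lemma lift_power:
  assumes "M \<in> \<rho> \<gamma>" "\<gamma> \<in> carrier surface_group"
  shows "matrix_power M n \<in> \<rho> \<gamma> [^]\<^bsub>PSL2R\<^esub> n"
proof -
  have M: "\<rho> \<gamma> = {M, - M}" by (rule lift_cases(2)[OF assms])
  have "\<rho> \<gamma> [^]\<^bsub>PSL2R\<^esub> n = {matrix_power M n, - matrix_power M n}" for n
  proof (induction n)
    case 0
    show ?case by (simp add: matrix_power_simps one_PSL2R)
  next
    case (Suc n)
    have comm: "matrix_power M n ** M = M ** matrix_power M n"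
      by (induction n) (simp_all add: matrix_power_simps flip: matrix_mul_assoc)
    have "\<rho> \<gamma> [^]\<^bsub>PSL2R\<^esub> Suc n = \<rho> \<gamma> [^]\<^bsub>PSL2R\<^esub> n \<otimes>\<^bsub>PSL2R\<^esub> \<rho> \<gamma>" by simp
    also have "\<dots> = {matrix_power M n, - matrix_power M n} \<otimes>\<^bsub>PSL2R\<^esub> {M, - M}"
      unfolding Suc.IH using M by (rule arg_cong)
    finally show ?case unfolding mult_PSL2R matrix_power_simps comm .
  qed
  then show ?thesis by simp
qed

lemma arithmetic_trace_power:
  assumes "arithmetic_metric \<rho>" "M \<in> \<rho> \<gamma>" "\<gamma> \<in> carrier surface_group"
  obtains k a b q n where "real_number_field k" "totally_real k" "a \<in> k" "b \<in> k"
    "unramified_exactly_at_id k a b" "q \<in> quat_algebra k" "reduced_norm a b q = 1"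
    "n > 0" "\<bar>trace_power n (trace M)\<bar> = \<bar>2 * fst q\<bar>"
proof -
  obtain k a b \<Phi> O' h where ar: "real_number_field k" "totally_real k" "a \<in> k" "b \<in> k"
      "unramified_exactly_at_id k a b" "quat_order k a b O'" "matrix_iso a b \<Phi>" "h \<in> carrier PSL2R"
      "commensurable PSL2R (\<rho> ` carrier surface_group)
        ((\<lambda>X. h \<otimes>\<^bsub>PSL2R\<^esub> X \<otimes>\<^bsub>PSL2R\<^esub> inv\<^bsub>PSL2R\<^esub> h) ` norm_one_image a b \<Phi> O')"
    using assms(1) unfolding arithmetic_metric_def arithmetic_def by blast
  interpret PSL: group PSL2R by (rule group_PSL2R)
  interpret hom: group_hom surface_group PSL2R \<rho> by (rule hom)
  let ?K = "(\<lambda>X. h \<otimes>\<^bsub>PSL2R\<^esub> X \<otimes>\<^bsub>PSL2R\<^esub> inv\<^bsub>PSL2R\<^esub> h) ` norm_one_image a b \<Phi> O'"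
  have "quat_one \<in> {x \<in> O'. reduced_norm a b x = 1}" using ar(6) by (simp add: quat_order_def)
  then have "{\<Phi> quat_one, - \<Phi> quat_one} \<in> norm_one_image a b \<Phi> O'"
    unfolding norm_one_image_def by (rule imageI)
  then have "\<one>\<^bsub>PSL2R\<^esub> \<in> norm_one_image a b \<Phi> O'"
    unfolding matrix_iso_one[OF ar(7)] one_PSL2R .
  then have one: "\<one>\<^bsub>PSL2R\<^esub> \<in> ?K" using ar(8) by (intro image_eqI[of _ _ "\<one>\<^bsub>PSL2R\<^esub>"]) simp_all
  have pow: "\<rho> \<gamma> [^]\<^bsub>PSL2R\<^esub> i \<in> \<rho> ` carrier surface_group" for i :: nat
    using hom.hom_nat_pow[OF assms(3)] assms(3) by (metis hom.G.nat_pow_closed imageI)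
  have sub: "\<rho> ` carrier surface_group \<subseteq> carrier PSL2R" using hom.hom_closed by blast
  obtain n :: nat where n: "n > 0" "\<rho> \<gamma> [^]\<^bsub>PSL2R\<^esub> n \<in> ?K"
    using commensurable_power_mem[OF group_PSL2R pow hom.hom_closed[OF assms(3)] sub ar(9) one] by blast
  then obtain q where q: "q \<in> O'" "reduced_norm a b q = 1"
      "\<rho> \<gamma> [^]\<^bsub>PSL2R\<^esub> n = h \<otimes>\<^bsub>PSL2R\<^esub> {\<Phi> q, - \<Phi> q} \<otimes>\<^bsub>PSL2R\<^esub> inv\<^bsub>PSL2R\<^esub> h"
    unfolding norm_one_image_def by blast
  obtain H where H: "det H = 1" "h = {H, - H}" using ar(8) unfolding carrier_PSL2R by blast
  have "inv\<^bsub>PSL2R\<^esub> h = {sl2_inv H, - sl2_inv H}"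
  proof (rule PSL.inv_equality)
    show "{sl2_inv H, - sl2_inv H} \<otimes>\<^bsub>PSL2R\<^esub> h = \<one>\<^bsub>PSL2R\<^esub>"
      unfolding H(2) mult_PSL2R sl2_inv_left[OF H(1)] one_PSL2R ..
    show "{sl2_inv H, - sl2_inv H} \<in> carrier PSL2R"
      unfolding carrier_PSL2R using H(1) by (intro exI[of _ "sl2_inv H"]) simp
  qed (rule ar(8))
  then have eq: "\<rho> \<gamma> [^]\<^bsub>PSL2R\<^esub> n = {H ** \<Phi> q ** sl2_inv H, - (H ** \<Phi> q ** sl2_inv H)}"
    unfolding q(3) by (simp only: H(2) mult_PSL2R)
  have "\<rho> \<gamma> [^]\<^bsub>PSL2R\<^esub> n \<in> carrier PSL2R" using pow sub by blast
  then obtain N where N: "det N = 1" "\<rho> \<gamma> [^]\<^bsub>PSL2R\<^esub> n = {N, - N}" unfolding carrier_PSL2R by blast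
  have "H ** \<Phi> q ** sl2_inv H \<in> {N, - N}" unfolding N(2)[symmetric] eq by simp
  \<comment> \<open>The determinant is read off from membership in PSL(2,R), since the power of
    \<open>\<rho> \<gamma>\<close> has lifts of determinant 1.\<close>
  then have "det (H ** \<Phi> q ** sl2_inv H) = 1" using N(1) by auto
  then have "det (\<Phi> q) = 1" using H(1) by (simp add: det_mul)
  then have tr: "trace (\<Phi> q) = 2 * fst q" by (rule matrix_iso_trace[OF ar(7) q(2)])
  have "trace (H ** \<Phi> q ** sl2_inv H) = trace (sl2_inv H ** (H ** \<Phi> q))" by (rule trace_mul_sym)
  also have "\<dots> = 2 * fst q" using H(1) tr by (simp add: matrix_mul_assoc sl2_inv_left)
  finally have tr: "trace (H ** \<Phi> q ** sl2_inv H) = 2 * fst q" .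
  have "matrix_power M n \<in> {H ** \<Phi> q ** sl2_inv H, - (H ** \<Phi> q ** sl2_inv H)}"
    using lift_power[OF assms(2,3), of n] unfolding eq .
  then have "trace (matrix_power M n) = 2 * fst q \<or> trace (matrix_power M n) = - (2 * fst q)"
    unfolding insert_iff empty_iff using tr trace_uminus_2 by metis
  then have "\<bar>trace_power n (trace M)\<bar> = \<bar>2 * fst q\<bar>"
    unfolding trace_matrix_power[OF lift_cases(1)[OF assms(2,3)]] by (metis abs_minus_cancel)
  moreover have "q \<in> quat_algebra k" using q(1) ar(6) unfolding quat_order_def by blast
  ultimately show ?thesis using that ar(1-5) q(2) n(1) by blast
qed

end

text \<open>For negative \<open>\<sigma> a\<close> and \<open>\<sigma> b\<close> the image of the
  norm equation writes 1 as a sum of nonnegative terms, one of which is the square of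
  \<open>\<sigma> (fst q)\<close>.\<close>

lemma embedded_reduced_norm_bound:
  fixes \<sigma> :: "real \<Rightarrow> real"
  assumes "real_subfield_embedding k \<sigma>" "a \<in> k" "b \<in> k" "q \<in> quat_algebra k" "reduced_norm a b q = 1"
    and "\<sigma> a < 0" "\<sigma> b < 0"
  shows "\<bar>\<sigma> (fst q)\<bar> \<le> 1"
proof -
  interpret real_subfield_embedding k \<sigma> by fact
  obtain q0 q1 q2 q3 where q: "q = (q0, q1, q2, q3)" by (cases q)
  have mem: "q0 \<in> k" "q1 \<in> k" "q2 \<in> k" "q3 \<in> k" using assms(4) unfolding q quat_algebra_def by auto
  note cl = mult_mem diff_mem add_mem mem assms(2,3)
  have "q0 * q0 - a * (q1 * q1) - b * (q2 * q2) + a * b * (q3 * q3) = 1"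
    using assms(5) by (simp add: q power2_eq_square)
  then have "\<sigma> (q0 * q0 - a * (q1 * q1) - b * (q2 * q2) + a * b * (q3 * q3)) = 1"
    using map_one by simp
  then have "\<sigma> q0 * \<sigma> q0 - \<sigma> a * (\<sigma> q1 * \<sigma> q1) - \<sigma> b * (\<sigma> q2 * \<sigma> q2)
      + \<sigma> a * \<sigma> b * (\<sigma> q3 * \<sigma> q3) = 1"
    by (simp only: map_add map_diff map_mult cl)
  moreover have "\<sigma> a * (\<sigma> q1 * \<sigma> q1) \<le> 0" "\<sigma> b * (\<sigma> q2 * \<sigma> q2) \<le> 0"
      "\<sigma> a * \<sigma> b * (\<sigma> q3 * \<sigma> q3) \<ge> 0"
    using assms(6,7) by (simp_all add: mult_le_0_iff mult_neg_neg zero_le_mult_iff)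
  ultimately have "\<sigma> q0 * \<sigma> q0 \<le> 1" by linarith
  then show ?thesis by (simp add: q abs_square_le_1[symmetric] power2_eq_square)
qed

theorem lemma3p6:
  fixes \<rho> :: "surface_word set \<Rightarrow> (real^2^2) set"
    and x :: "nat \<Rightarrow> real"
  assumes "hyperbolic_metric \<rho>"
    and "\<forall>i\<in>{1..9}. x i = Tr \<rho> (gamma i)"
    and "x 1 = x 2" and "x 2 = x 3" and "x 3 = x 4" and "x 4 = x 5"
    and "x 5 = x 6" and "x 6 = x 8"
    and "x 9 = Tr \<rho> (gamma 1 [^]\<^bsub>surface_group\<^esub> (2::nat))"
    and "Tr \<rho> (gamma 1 [^]\<^bsub>surface_group\<^esub> (2::nat)) = (x 1)\<^sup>2 - 2"
  shows "\<not> arithmetic_metric \<rho>"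
proof
  assume ar: "arithmetic_metric \<rho>"
  interpret holonomy \<rho> by unfold_locales (rule assms(1))
  define t where "t = x 1"
  have "Tr \<rho> (gamma i) = x i" if "i \<in> {1..9}" for i using assms(2) that by simp
  then have Tr: "Tr \<rho> (gamma 1) = t" "Tr \<rho> (gamma 2) = t" "Tr \<rho> (gamma 3) = t" "Tr \<rho> (gamma 4) = t"
      "Tr \<rho> (gamma 5) = t" "Tr \<rho> (gamma 6) = t" "Tr \<rho> (gamma 8) = t" "Tr \<rho> (gamma 9) = t\<^sup>2 - 2"
    using assms(3-10) by (simp_all add: t_def)
  obtain M where M: "M \<in> \<rho> (gamma 1)" "trace M = t" "t \<ge> 3"
      "t^5 - 9 * t^4 + 2 * t^3 + 11 * t^2 - 4 * t - 4 = 0"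
    using surface_traces[OF Tr] by blast
  have root: "poly quintic t = 0"
    using M(4) by (simp add: algebra_simps eval_nat_numeral)
  note t = quintic_root_bounds[OF M(3) root]
  obtain z :: complex where z: "poly quintic z = 0" "z \<notin> \<real>" "cmod z < 3"
    using quintic_nonreal_root[OF t root] by blast
  obtain k a b q n where k: "real_number_field k" "totally_real k" "a \<in> k" "b \<in> k"
      "unramified_exactly_at_id k a b" and q: "q \<in> quat_algebra k" "reduced_norm a b q = 1"
    and n: "n > 0" "\<bar>trace_power n (trace M)\<bar> = \<bar>2 * fst q\<bar>"
    by (rule arithmetic_trace_power[OF ar M(1)]) (simp_all add: gamma_def)
  have "poly (map_poly of_real quintic) z = 0" using z(1) by (simp add: map_poly_pCons)
  then obtain F \<sigma> where F: "real_subfield_embedding F \<sigma>" "k \<subseteq> F" "t \<in> F" "\<sigma> t = z"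
    by (rule real_number_field_embedding_exists[OF k(1) quintic_minimal_poly[OF root]])
  interpret F: real_subfield_embedding F \<sigma> by (rule F(1))
  have q0: "fst q \<in> k" using q(1) by (auto simp: quat_algebra_def)
  have emb: "field_embedding k \<sigma>"
    using F.embedding F(2) unfolding field_embedding_def by blast
  then have real: "\<sigma> y \<in> \<real>" if "y \<in> k" for y
    using k(2) that unfolding totally_real_def by blast
  \<comment> \<open>Total reality makes \<open>\<sigma>\<close> real on \<open>k\<close>;
    \<open>\<tau>\<close> is the same embedding with values in the reals, the form in which
    ramification is stated.\<close>
  define \<tau> where "\<tau> = Re \<circ> \<sigma>"
  have \<tau>: "\<sigma> y = of_real (\<tau> y)" if "y \<in> k" for y
    using real[OF that] by (simp add: \<tau>_def)
  interpret k: real_subfield k by (rule real_number_field_real_subfield[OF k(1)])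
  have "field_embedding k \<tau>"
    using emb real unfolding field_embedding_def \<tau>_def
    by (auto simp: complex_is_Real_iff)
  then have k\<tau>: "real_subfield_embedding k \<tau>" by unfold_locales
  have two: "\<sigma> 2 = 2" using F.map_add[OF F.one_mem F.one_mem] F.map_one by simp
  have q0F: "fst q \<in> F" "2 \<in> F" using q0 F(2) F.of_nat_mem[of 2] by auto
  \<comment> \<open>Commensurability is seen only in PSL(2,R), so the trace is known up to sign; the
    sign is rational and passes through \<open>\<sigma>\<close>.\<close>
  obtain e where e: "e = 1 \<or> e = - 1" "trace_power n t = e * (2 * fst q)"
    using n(2) M(2) that[of 1] that[of "- 1"] by (auto simp: abs_eq_iff)
  have "trace_power n z = \<sigma> (trace_power n t)" using F.map_trace_power[OF F(3), of n] F(4) by simp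
  also have "\<dots> = of_real (e * (2 * \<tau> (fst q)))"
    using e q0F two \<tau>[OF q0] by (auto simp: F.map_uminus F.map_mult F.mult_mem)
  finally have Tz: "trace_power n z = of_real (e * (2 * \<tau> (fst q)))" .
  show False
  proof (cases "\<exists>y\<in>k. \<tau> y \<noteq> y")
    case True
    then obtain \<Psi> where "hamilton_iso (\<tau> a) (\<tau> b) \<Psi>"
      using k(5) \<open>field_embedding k \<tau>\<close> unfolding unramified_exactly_at_id_def by blast
    then have "\<bar>\<tau> (fst q)\<bar> \<le> 1"
      using embedded_reduced_norm_bound[OF k\<tau> k(3,4) q] hamilton_iso_negative by blast
    then have "\<bar>e * (2 * \<tau> (fst q))\<bar> \<le> 2" using e(1) by auto
    then show False using trace_power_bounded_real[OF n(1) Tz] z(2) by blast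
  next
    case False
    then have "trace_power n z = of_real (trace_power n t)" using Tz e(2) q0 by simp
    then show False using trace_power_neq[OF n(1) t(1) z(3)] by blast
  qed
qed

end
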